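(* Let $X$ be an $n$-dimensional normed space ($n\ge 1$) over $\mathbb{K}\in\{\mathbb{R},\mathbb{C}\}$ whose John ellipsoid and Loewner ellipsoid are proportional (i.e. one is a positive scalar multiple of the other). Then \[\rho_\infty(X)=\frac{n}{\mathrm{d}(X,\ell_2^n)}.\]
   Context: $X^*$ denotes the dual space of $X$ and $B_{X^*}$ its unit ball; $B_X$ is the unit ball of $X$. For an integer $k\ge 1$, the algebraic tensor power $X^{\otimes k}$ carries the injective norm $\|z\|_{\varepsilon_k(X)}=\sup\{|(\lambda_1\otimes\cdots\otimes\lambda_k)(z)| : \lambda_1,\dots,\lambda_k\in B_{X^*}\}$ and the projective norm $\|z\|_{\pi_k(X)}=\inf\{\sum_{i=1}^m \|x_i^{(1)}\|_X\cdots\|x_i^{(k)}\|_X : m\in\mathbb{N},\ z=\sum_{i=1}^m x_i^{(1)}\otimes\cdots\otimes x_i^{(k)}\}$. Define $\rho_k(X)=\left(\sup_{z\in X^{\otimes k},\, z\ne 0}\frac{\|z\|_{\pi_k(X)}}{\|z\|_{\varepsilon_k(X)}}\right)^{1/k}$ and the tensor radius $\rho_\infty(X)=\lim_{k\to\infty}\rho_k(X)$ (this limit exists). $\ell_2^n$ is $\mathbb{K}^n$ with its standard Euclidean norm. The Banach--Mazur distance is $\mathrm{d}(X,Y)=\inf\{\|U\|_{X\to Y}\|U^{-1}\|_{Y\to X} : U:X\to Y \text{ a linear bijection}\}$. An ellipsoid in an $n$-dimensional space $X$ is the image of the closed unit ball of $\ell_2^n$ under a linear map $\mathbb{K}^n\to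 X$. The John ellipsoid of $X$ is the unique ellipsoid of maximal volume contained in $B_X$; the Loewner ellipsoid of $X$ is the unique ellipsoid of minimal volume containing $B_X$. *)

theory Defs
  imports "HOL-Analysis.Analysis"
begin

text \<open>
  A normed space over \<open>'k\<close> (only \<open>'k = real\<close> and \<open>'k = complex\<close> are of interest) is given by its
  scalar multiplication and its norm, the underlying set being the whole type \<open>'a\<close>.
\<close>

locale normed_space = vector_space smul
  for smul :: "'k::real_normed_field \<Rightarrow> 'a::ab_group_add \<Rightarrow> 'a" +
  fixes N :: "'a \<Rightarrow> real"
  assumes norm_nonneg: "0 \<le> N x"
    and norm_eq_zero_iff: "N x = 0 \<longleftrightarrow> x = 0"
    and norm_scale: "N (smul c x) = norm c * N x"
    and norm_triangle: "N (x + y) \<le> N x + N y"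

definition unit_ball :: "('a \<Rightarrow> real) \<Rightarrow> 'a set" where
  "unit_ball N = {x. N x \<le> 1}"

definition dual_unit_ball ::
    "('k::real_normed_field \<Rightarrow> 'a::ab_group_add \<Rightarrow> 'a) \<Rightarrow> ('a \<Rightarrow> real) \<Rightarrow> ('a \<Rightarrow> 'k) set" where
  "dual_unit_ball smul N =
     {l. Vector_Spaces.linear smul (*) l \<and> (\<forall>x\<in>unit_ball N. norm (l x) \<le> 1)}"

subsection \<open>Tensor powers\<close>

definition multilinear_form ::
    "('k::real_normed_field \<Rightarrow> 'a::ab_group_add \<Rightarrow> 'a) \<Rightarrow> nat \<Rightarrow> ('a list \<Rightarrow> 'k) \<Rightarrow> bool" where
  "multilinear_form smul k A \<longleftrightarrow>
     (\<forall>xs i. length xs = k \<and> i < k \<longrightarrow> Vector_Spaces.linear smul (*) (\<lambda>v. A (xs[i := v])))"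

text \<open>
  The algebraic tensor power is realised in the usual way inside the space of functionals on
  \<open>k\<close>-linear forms: \<open>x\<^sub>1 \<otimes> \<dots> \<otimes> x\<^sub>k\<close> is the functional \<open>A \<mapsto> A (x\<^sub>1, \<dots>, x\<^sub>k)\<close>, and the tensor power
  is the linear span of these. The value 0 on arguments that are not \<open>k\<close>-linear only serves to
  make equality of tensors coincide with equality of HOL functions.
\<close>

definition elementary_tensor ::
    "('k::real_normed_field \<Rightarrow> 'a::ab_group_add \<Rightarrow> 'a) \<Rightarrow> 'a list \<Rightarrow> ('a list \<Rightarrow> 'k) \<Rightarrow> 'k" where
  "elementary_tensor smul xs = (\<lambda>A. if multilinear_form smul (length xs) A then A xs else 0)"

definition tensor_power ::
    "('k::real_normed_field \<Rightarrow> 'a::ab_group_add \<Rightarrow> 'a) \<Rightarrow> nat \<Rightarrow> (('a list \<Rightarrow> 'k) \<Rightarrow> 'k) set" where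
  "tensor_power smul k =
     {z. \<exists>(m::nat) c x. (\<forall>i<m. length (x i) = k) \<and>
           z = (\<lambda>A. \<Sum>i<m. c i * elementary_tensor smul (x i) A)}"

text \<open>
  The functional \<open>\<lambda>\<^sub>1 \<otimes> \<dots> \<otimes> \<lambda>\<^sub>k\<close> sends \<open>x\<^sub>1 \<otimes> \<dots> \<otimes> x\<^sub>k\<close> to \<open>\<lambda>\<^sub>1(x\<^sub>1) \<cdots> \<lambda>\<^sub>k(x\<^sub>k)\<close>; so on a general tensor
  \<open>z\<close> it is evaluation of \<open>z\<close> at the \<open>k\<close>-linear form \<open>(x\<^sub>1, \<dots>, x\<^sub>k) \<mapsto> \<lambda>\<^sub>1(x\<^sub>1) \<cdots> \<lambda>\<^sub>k(x\<^sub>k)\<close>.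
\<close>

definition tensor_functional ::
    "nat \<Rightarrow> (nat \<Rightarrow> 'a \<Rightarrow> 'k::real_normed_field) \<Rightarrow> (('a list \<Rightarrow> 'k) \<Rightarrow> 'k) \<Rightarrow> 'k" where
  "tensor_functional k l z = z (\<lambda>xs. \<Prod>j<k. l j (xs ! j))"

definition injective_norm ::
    "('k::real_normed_field \<Rightarrow> 'a::ab_group_add \<Rightarrow> 'a) \<Rightarrow> ('a \<Rightarrow> real) \<Rightarrow> nat
      \<Rightarrow> (('a list \<Rightarrow> 'k) \<Rightarrow> 'k) \<Rightarrow> real" where
  "injective_norm smul N k z =
     Sup {norm (tensor_functional k l z) | l. \<forall>j<k. l j \<in> dual_unit_ball smul N}"

definition projective_norm ::
    "('k::real_normed_field \<Rightarrow> 'a::ab_group_add \<Rightarrow> 'a) \<Rightarrow> ('a \<Rightarrow> real) \<Rightarrow> nat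
      \<Rightarrow> (('a list \<Rightarrow> 'k) \<Rightarrow> 'k) \<Rightarrow> real" where
  "projective_norm smul N k z =
     Inf {\<Sum>i<m. \<Prod>j<k. N (x i ! j) | (m::nat) x.
            (\<forall>i<m. length (x i) = k) \<and> z = (\<lambda>A. \<Sum>i<m. elementary_tensor smul (x i) A)}"

definition tensor_ratio_root ::
    "('k::real_normed_field \<Rightarrow> 'a::ab_group_add \<Rightarrow> 'a) \<Rightarrow> ('a \<Rightarrow> real) \<Rightarrow> nat \<Rightarrow> real" where
  "tensor_ratio_root smul N k =
     root k (Sup {projective_norm smul N k z / injective_norm smul N k z | z.
                    z \<in> tensor_power smul k \<and> z \<noteq> (\<lambda>A. 0)})"

definition tensor_radius ::
    "('k::real_normed_field \<Rightarrow> 'a::ab_group_add \<Rightarrow> 'a) \<Rightarrow> ('a \<Rightarrow> real) \<Rightarrow> real" where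
  "tensor_radius smul N = lim (\<lambda>k. tensor_ratio_root smul N k)"

subsection \<open>Banach--Mazur distance\<close>

definition operator_norm :: "('a \<Rightarrow> real) \<Rightarrow> ('b \<Rightarrow> real) \<Rightarrow> ('a \<Rightarrow> 'b) \<Rightarrow> real" where
  "operator_norm N M U = Sup {M (U x) | x. x \<in> unit_ball N}"

definition banach_mazur_distance ::
    "('k::real_normed_field \<Rightarrow> 'a::ab_group_add \<Rightarrow> 'a) \<Rightarrow> ('a \<Rightarrow> real)
      \<Rightarrow> ('k \<Rightarrow> 'b::ab_group_add \<Rightarrow> 'b) \<Rightarrow> ('b \<Rightarrow> real) \<Rightarrow> real" where
  "banach_mazur_distance smul N smul' M =
     Inf {operator_norm N M U * operator_norm M N (inv U) | U.
            Vector_Spaces.linear smul smul' U \<and> bij U}"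

subsection \<open>John and Loewner ellipsoids\<close>

text \<open>
  The type argument \<open>'n\<close> fixes the dimension \<open>n = CARD('n)\<close>; the space \<open>\<ell>\<^sub>2\<^sup>n\<close> is \<open>'k ^ 'n\<close>, whose
  library norm is the Euclidean one.
\<close>

definition ellipsoid ::
    "'n::finite itself \<Rightarrow> ('k::{real_normed_field, euclidean_space} \<Rightarrow> 'a::ab_group_add \<Rightarrow> 'a)
      \<Rightarrow> 'a set \<Rightarrow> bool" where
  "ellipsoid _ smul E \<longleftrightarrow>
     (\<exists>T :: 'k ^ 'n \<Rightarrow> 'a. Vector_Spaces.linear (*s) smul T \<and> E = T ` cball 0 1)"

text \<open>
  Volume in an abstract \<open>n\<close>-dimensional space is Lebesgue measure with respect to linear
  coordinates \<open>\<phi>\<close>. Changing \<open>\<phi>\<close> multiplies it by a positive constant, so the comparisons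
  below do not depend on the choice of coordinates.
\<close>

definition coordinates ::
    "('k::{real_normed_field, euclidean_space} \<Rightarrow> 'a::ab_group_add \<Rightarrow> 'a)
      \<Rightarrow> ('k ^ 'n::finite \<Rightarrow> 'a) \<Rightarrow> bool" where
  "coordinates smul \<phi> \<longleftrightarrow> Vector_Spaces.linear (*s) smul \<phi> \<and> bij \<phi>"

definition volume ::
    "('k::{real_normed_field, euclidean_space} ^ 'n::finite \<Rightarrow> 'a) \<Rightarrow> 'a set \<Rightarrow> real" where
  "volume \<phi> E = measure lebesgue (\<phi> -` E)"

definition is_john_ellipsoid ::
    "'n::finite itself \<Rightarrow> ('k::{real_normed_field, euclidean_space} \<Rightarrow> 'a::ab_group_add \<Rightarrow> 'a)
      \<Rightarrow> ('a \<Rightarrow> real) \<Rightarrow> 'a set \<Rightarrow> bool" where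
  "is_john_ellipsoid n smul N E \<longleftrightarrow>
     ellipsoid n smul E \<and> E \<subseteq> unit_ball N \<and>
     (\<forall>(\<phi> :: 'k ^ 'n \<Rightarrow> 'a) E'. coordinates smul \<phi> \<longrightarrow> ellipsoid n smul E' \<longrightarrow> E' \<subseteq> unit_ball N
        \<longrightarrow> volume \<phi> E' \<le> volume \<phi> E)"

definition is_loewner_ellipsoid ::
    "'n::finite itself \<Rightarrow> ('k::{real_normed_field, euclidean_space} \<Rightarrow> 'a::ab_group_add \<Rightarrow> 'a)
      \<Rightarrow> ('a \<Rightarrow> real) \<Rightarrow> 'a set \<Rightarrow> bool" where
  "is_loewner_ellipsoid n smul N E \<longleftrightarrow>
     ellipsoid n smul E \<and> unit_ball N \<subseteq> E \<and>
     (\<forall>(\<phi> :: 'k ^ 'n \<Rightarrow> 'a) E'. coordinates smul \<phi> \<longrightarrow> ellipsoid n smul E' \<longrightarrow> unit_ball N \<subseteq> E'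
        \<longrightarrow> volume \<phi> E \<le> volume \<phi> E')"

definition proportional ::
    "('k::real_normed_field \<Rightarrow> 'a::ab_group_add \<Rightarrow> 'a) \<Rightarrow> 'a set \<Rightarrow> 'a set \<Rightarrow> bool" where
  "proportional smul E F \<longleftrightarrow> (\<exists>c>0. F = smul (of_real c) ` E)"

end

theory Submission imports Defs
begin

text \<open>
  After a change of coordinates the John ellipsoid is the Euclidean ball of \<open>K\<^sup>n\<close> and the Loewner
  ellipsoid its multiple by \<open>c\<close>, so that \<open>norm x / c \<le> N x \<le> norm x\<close>. Comparing volumes of ellipsoids
  shows that \<open>c\<close> is the Banach--Mazur distance to the Euclidean space.

  Upper bound. By John's theorem a multiple of the identity is an average of rank one operators
  \<open>v v\<^sup>*\<close> both over vectors \<open>v\<close> of the unit ball (Loewner) and over functionals of the dual unit ball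
  (John). Expanding \<open>z\<close> along the \<open>k\<close>-fold tensor power of the first average and applying
  Cauchy--Schwarz bounds the projective norm by a Euclidean norm; the second average bounds that
  Euclidean norm by the injective norm. The total cost is the factor \<open>(n / c)\<^sup>k\<close>.

  Lower bound. The tensor \<open>z\<close> with suitable signs as coordinates has injective norm
  \<open>O(k (1 - \<delta>)\<^sup>-\<^sup>k)\<close> for every \<open>\<delta> > 0\<close> (the signs are chosen for a finite \<open>\<delta>\<close>-net of the ball), and
  pairing it with the form having the same coordinates bounds its projective norm from below by
  \<open>n\<^sup>k c\<^sup>-\<^sup>k\<close> divided by the same quantity. Now let \<open>k \<longrightarrow> \<infinity>\<close> and then \<open>\<delta> \<longrightarrow> 0\<close>.
\<close>

subsection \<open>Determinants and volumes in Euclidean spaces\<close>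

text \<open>Proportionality makes both extremal ellipsoids balls of one inner product. The two
  decompositions then resolve multiples of the same identity, so their k-fold tensor powers define
  one Hilbert norm on tensors, up to the factor c^(2k). That norm is where the projective and
  injective sides meet: the expansion costs (n / c^2)^k, the change of frame costs c^k after a
  square root, and the product is (n / c)^k. In the lower bound the bound G of the sign form enters
  squared, once through the tensor and once through the form paired with it. Plain Cauchy-Schwarz
  gives G = n^(k/2), which would destroy the whole gain n^k. Balanced signs bring G down to the
  logarithm of the number of test points; as these are only exponentially many in k, the logarithm
  is linear in k, and its k-th root is harmless. Real and complex scalars are treated together:
  convexity and volume use the real inner product and real determinants, the tensor computations a
  scalar-valued form compatible with it.\<close>

typedef (overloaded) 'a basis_index = "{..<DIM('a::euclidean_space)}"
  using DIM_positive lessThan_iff by blast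

instance basis_index :: (euclidean_space) finite
proof
  show "finite (UNIV :: 'a basis_index set)"
    unfolding type_definition.univ[OF type_definition_basis_index] by simp
qed

instantiation basis_index :: (euclidean_space) wellorder
begin

definition "i \<le> j \<longleftrightarrow> Rep_basis_index i \<le> Rep_basis_index j"

definition "i < j \<longleftrightarrow> Rep_basis_index i < Rep_basis_index j"

instance
proof
  fix P :: "'a basis_index \<Rightarrow> bool" and a
  assume step: "\<And>x. (\<And>y. y < x \<Longrightarrow> P y) \<Longrightarrow> P x"
  show "P a"
    by (induction "Rep_basis_index a" arbitrary: a rule: less_induct)
      (metis step less_basis_index_def)
qed (auto simp: less_eq_basis_index_def less_basis_index_def Rep_basis_index_inject)

end

lemma card_basis_index: "CARD('a::euclidean_space basis_index) = DIM('a)"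
  using type_definition.card[OF type_definition_basis_index] by (metis card_lessThan)

definition basis_enum :: "'a::euclidean_space basis_index \<Rightarrow> 'a" where
  "basis_enum = (SOME f. bij_betw f UNIV Basis)"

lemma basis_enum: "bij_betw (basis_enum :: 'a::euclidean_space basis_index \<Rightarrow> 'a) UNIV Basis"
proof -
  have "\<exists>f :: 'a basis_index \<Rightarrow> 'a. bij_betw f UNIV Basis"
    by (rule finite_same_card_bij) (simp_all add: card_basis_index)
  then show ?thesis unfolding basis_enum_def by (rule someI_ex)
qed

lemma basis_enum_Basis: "basis_enum i \<in> Basis"
  using basis_enum bij_betwE by blast

lemma inner_basis_enum: "basis_enum i \<bullet> basis_enum j = (if i = j then 1 else 0)"
  using basis_enum unfolding bij_betw_def inj_on_def by (metis UNIV_I basis_enum_Basis inner_Basis)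

lemma sum_basis_enum: "(\<Sum>b\<in>Basis. g b) = (\<Sum>i\<in>UNIV. g (basis_enum i))"
  using sum.reindex_bij_betw[OF basis_enum] by metis

text \<open>The detour through \<open>basis_index\<close> is needed because the library's volume formula for linear maps is
  only available on \<open>real ^ 'm\<close> with a well-ordered index type \<open>'m\<close>.\<close>

definition eucl_det :: "('a::euclidean_space \<Rightarrow> 'a) \<Rightarrow> real" where
  "eucl_det f = det (\<chi> i j. f (basis_enum j) \<bullet> basis_enum i)"

definition from_coords :: "real ^ 'a basis_index \<Rightarrow> 'a::euclidean_space" where
  "from_coords x = (\<Sum>i\<in>UNIV. x $ i *\<^sub>R basis_enum i)"

lemma inner_from_coords: "from_coords x \<bullet> basis_enum i = x $ i"
  by (simp add: from_coords_def inner_sum_left inner_basis_enum if_distrib cong: if_cong)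

lemma from_coords_inner: "from_coords (\<chi> i. y \<bullet> basis_enum i) = y"
  unfolding from_coords_def using sum_basis_enum[of "\<lambda>b. (y \<bullet> b) *\<^sub>R b"] euclidean_representation[of y] by simp

lemma linear_from_coords: "linear (from_coords)"
  by (rule linearI)
    (simp_all add: from_coords_def scaleR_add_left sum.distrib scaleR_sum_right)

lemma from_coords_axis: "from_coords (axis j 1) = basis_enum j"
  by (simp add: from_coords_def axis_def if_distrib[of "\<lambda>x. x *\<^sub>R _"] cong: if_cong)

text \<open>Lebesgue measure is determined by its values on boxes, and \<open>from_coords\<close>
  matches boxes with boxes of the same side lengths.\<close>

lemma lborel_from_coords: "distr lborel borel (from_coords) = lborel"
proof (rule lborel_eqI[symmetric])
  fix l u :: "'a::euclidean_space" assume le: "\<And>b. b \<in> Basis \<Longrightarrow> l \<bullet> b \<le> u \<bullet> b"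
  have [measurable]: "from_coords \<in> borel_measurable borel"
    using linear_from_coords by (intro borel_measurable_continuous_onI linear_continuous_on)
      (simp add: linear_conv_bounded_linear)
  have "from_coords -` box l u = box (\<chi> i. l \<bullet> basis_enum i) (\<chi> i. u \<bullet> basis_enum i)"
  proof -
    have "(\<forall>b\<in>Basis. l \<bullet> b < v \<bullet> b \<and> v \<bullet> b < u \<bullet> b) \<longleftrightarrow>
          (\<forall>i. l \<bullet> basis_enum i < v \<bullet> basis_enum i \<and> v \<bullet> basis_enum i < u \<bullet> basis_enum i)" for v
      using basis_enum[where 'a = 'a] unfolding bij_betw_def by (metis basis_enum_Basis imageE)
    then show ?thesis by (auto simp: box_def[of l u] mem_box_cart inner_from_coords)
  qed
  moreover have "emeasure lborel (box (\<chi> i. l \<bullet> basis_enum i) (\<chi> i. u \<bullet> basis_enum i)) = (\<Prod>b\<in>Basis. (u - l) \<bullet> b)"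
  proof -
    have "(\<Prod>b\<in>Basis. (u - l) \<bullet> b) = (\<Prod>i\<in>UNIV. (u - l) \<bullet> basis_enum i)"
      using prod.reindex_bij_betw[OF basis_enum] by metis
    moreover have "(\<Prod>b\<in>Basis. ((\<chi> i. u \<bullet> basis_enum i) - (\<chi> i. l \<bullet> basis_enum i) :: real ^ 'a basis_index) \<bullet> b)
        = (\<Prod>i\<in>UNIV. (u - l) \<bullet> basis_enum i)"
      by (simp add: Basis_vec_def prod.UNION_disjoint axis_eq_axis inner_axis inner_diff_left)
    moreover have "emeasure lborel (box (\<chi> i. l \<bullet> basis_enum i) (\<chi> i. u \<bullet> basis_enum i) :: (real ^ 'a basis_index) set) =
        (\<Prod>b\<in>Basis. ((\<chi> i. u \<bullet> basis_enum i) - (\<chi> i. l \<bullet> basis_enum i) :: real ^ 'a basis_index) \<bullet> b)"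
      by (rule emeasure_lborel_box) (auto simp: Basis_vec_def inner_axis le basis_enum_Basis)
    ultimately show ?thesis by simp
  qed
  ultimately show "emeasure (distr lborel borel (from_coords)) (box l u) = (\<Prod>b\<in>Basis. (u - l) \<bullet> b)"
    by (simp add: emeasure_distr)
qed simp

text \<open>Conjugating \<open>f\<close> by the measure preserving \<open>from_coords\<close> gives
  a map \<open>g\<close> on coordinates whose matrix is the one in \<open>eucl_det\<close>.
  Compactness settles the measurability of all images and preimages involved.\<close>

lemma measure_linear_image_compact:
  assumes f: "linear f" and S: "compact (S :: 'a::euclidean_space set)"
  shows "measure lebesgue (f ` S) = \<bar>eucl_det f\<bar> * measure lebesgue S"
proof -
  define g where "g x = (\<chi> i. f (from_coords x) \<bullet> basis_enum i)" for x
  have cont: "continuous_on A (from_coords)" "continuous_on B f" for A B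
    using linear_from_coords f by (auto simp: linear_conv_bounded_linear intro!: linear_continuous_on)
  have [measurable]: "from_coords \<in> borel_measurable borel"
    using cont by (intro borel_measurable_continuous_onI) auto
  have m: "measure lebesgue C = measure lebesgue (from_coords -` C)" if "compact C" for C
  proof -
    have C: "C \<in> sets borel" using that borel_compact by blast
    then have C': "from_coords -` C \<in> sets borel"
      using measurable_sets[of "from_coords" borel borel C] by simp
    have "measure lebesgue C = measure (distr lborel borel (from_coords)) C"
      using C by (simp add: lborel_from_coords measure_completion)
    also have "\<dots> = measure lborel (from_coords -` C)"
      using C by (simp add: measure_distr)
    finally show ?thesis using C' by (simp add: measure_completion)
  qed
  have lg: "linear g"
    unfolding g_def
    by (rule linearI)
      (simp_all add: linear_add[OF linear_from_coords] linear_add[OF f]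
        linear_scale[OF linear_from_coords] linear_scale[OF f] vec_eq_iff inner_add_left)
  have mg: "matrix g = (\<chi> i j. f (basis_enum j) \<bullet> basis_enum i)"
    by (simp add: matrix_def g_def from_coords_axis)
  have inj: "from_coords x = from_coords y \<longleftrightarrow> x = y" for x y
    by (metis inner_from_coords vec_eq_iff)
  have vim: "from_coords -` C = (\<lambda>y. \<chi> i. y \<bullet> basis_enum i) ` C" for C
    by (force simp: image_iff from_coords_inner inner_from_coords vec_eq_iff)
  have "compact (from_coords -` S)"
    unfolding vim by (intro compact_continuous_image S) (auto intro!: continuous_intros)
  then have lm: "from_coords -` S \<in> lmeasurable"
    using lmeasurable_compact by blast
  have "from_coords -` (f ` S) = g ` (from_coords -` S)"
    unfolding vim image_image g_def by (simp add: from_coords_inner)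
  moreover have "measure lebesgue (f ` S) = measure lebesgue (from_coords -` (f ` S))"
    by (intro m compact_continuous_image S cont)
  ultimately show ?thesis
    using measure_linear_image[OF lg lm] m[OF S] by (simp add: mg eucl_det_def)
qed

lemma eucl_det_adjoint: "linear f \<Longrightarrow> eucl_det (adjoint f) = eucl_det f"
proof -
  assume "linear f"
  then have "(\<chi> i j. adjoint f (basis_enum j) \<bullet> basis_enum i) = transpose (\<chi> i j. f (basis_enum j) \<bullet> basis_enum i)"
    by (simp add: transpose_def vec_eq_iff adjoint_works adjoint_clauses inner_commute)
  then show ?thesis by (simp add: eucl_det_def)
qed

text \<open>Jacobi's formula at the identity, read off the Leibniz expansion: only the identity
  permutation contributes to first order.\<close>

lemma has_derivative_det_perturbation:
  fixes A :: "real ^ 'm::finite ^ 'm"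
  shows "((\<lambda>e. det (mat 1 + e *\<^sub>R A)) has_real_derivative (\<Sum>i\<in>UNIV. A $ i $ i)) (at 0)"
proof -
  define F where "F p e = of_int (sign p) * (\<Prod>i\<in>UNIV. ((if i = p i then 1 else 0) + e * A $ i $ p i))"
    for p :: "'m \<Rightarrow> 'm" and e :: real
  have F: "(F p has_real_derivative (if p = id then (\<Sum>i\<in>UNIV. A $ i $ i) else 0)) (at 0)"
    if p: "p permutes UNIV" for p
  proof -
    have d: "((\<lambda>e. \<Prod>i\<in>UNIV. ((if i = p i then 1 else 0) + e * A $ i $ p i)) has_real_derivative
       (\<Sum>i\<in>UNIV. A $ i $ p i * (\<Prod>j\<in>UNIV - {i}. ((if j = p j then 1 else 0) + 0 * A $ j $ p j)))) (at 0)"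
      by (rule has_field_derivative_prod) (auto intro!: derivative_eq_intros)
    have "F p = (\<lambda>e. of_int (sign p) * (\<Prod>i\<in>UNIV. ((if i = p i then 1 else 0) + e * A $ i $ p i)))"
      by (simp add: F_def fun_eq_iff)
    then have d': "(F p has_real_derivative of_int (sign p) *
       (\<Sum>i\<in>UNIV. A $ i $ p i * (\<Prod>j\<in>UNIV - {i}. ((if j = p j then 1 else 0) + 0 * A $ j $ p j)))) (at 0)"
      using DERIV_cmult[OF d, of "of_int (sign p)"] by metis
    show ?thesis
    proof (cases "p = id")
      case True
      then show ?thesis using d' by (simp add: sign_id)
    next
      case False
      \<comment> \<open>A permutation other than \<open>id\<close> moves at least two indices.
        Whichever factor \<open>i\<close> is differentiated, another off-diagonal factor survives
        and vanishes at 0.\<close>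
      have "\<exists>j\<in>UNIV - {i}. j \<noteq> p j" for i
      proof (rule ccontr)
        assume "\<not> (\<exists>j\<in>UNIV - {i}. j \<noteq> p j)"
        then have *: "\<And>j. j \<noteq> i \<Longrightarrow> p j = j" by auto
        then have "p i = i" using p by (metis permutes_univ)
        with * False show False by (metis eq_id_iff)
      qed
      then have z: "(\<Prod>j\<in>UNIV - {i}. ((if j = p j then 1 else 0) + 0 * A $ j $ p j)) = 0" for i
        by (intro prod_zero) auto
      show ?thesis using d' False unfolding z by simp
    qed
  qed
  have "((\<lambda>e. \<Sum>p\<in>{p. p permutes (UNIV :: 'm set)}. F p e) has_real_derivative
      (\<Sum>p\<in>{p. p permutes (UNIV :: 'm set)}. if p = id then (\<Sum>i\<in>UNIV. A $ i $ i) else 0)) (at 0)"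
    by (rule DERIV_sum) (use F in auto)
  moreover have "(\<Sum>p\<in>{p. p permutes (UNIV :: 'm set)}. if p = id then (\<Sum>i\<in>UNIV. A $ i $ i) else 0)
      = (\<Sum>i\<in>UNIV. A $ i $ i)"
    by (simp add: finite_permutations permutes_id)
  moreover have "det (mat 1 + e *\<^sub>R A) = (\<Sum>p\<in>{p. p permutes (UNIV :: 'm set)}. F p e)" for e
    by (simp add: det_def F_def mat_def)
  ultimately show ?thesis by simp
qed

lemma has_derivative_eucl_det_perturbation:
  "((\<lambda>e. eucl_det (\<lambda>x. x + e *\<^sub>R f x)) has_real_derivative (\<Sum>b\<in>Basis. f b \<bullet> b)) (at 0)"
proof -
  have "(\<chi> i j. (basis_enum j + e *\<^sub>R f (basis_enum j)) \<bullet> basis_enum i) = mat 1 + e *\<^sub>R (\<chi> i j. f (basis_enum j) \<bullet> basis_enum i)" for e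
    by (auto simp: vec_eq_iff mat_def inner_add_left inner_basis_enum)
  then show ?thesis
    using has_derivative_det_perturbation[of "\<chi> i j. f (basis_enum j) \<bullet> basis_enum i"]
    by (simp add: eucl_det_def sum_basis_enum)
qed

lemma eucl_det_scaleR: "eucl_det (\<lambda>x. r *\<^sub>R f x :: 'a) = r ^ DIM('a::euclidean_space) * eucl_det f"
proof -
  have "(\<chi> i j. (r *\<^sub>R f (basis_enum j)) \<bullet> basis_enum i) = (\<chi> i. r *s ((\<chi> i j. f (basis_enum j) \<bullet> basis_enum i) $ i))"
    by (simp add: vec_eq_iff)
  moreover note card_basis_index[where 'a = 'a]
  ultimately show ?thesis
    by (simp add: eucl_det_def det_rows_mul)
qed

lemma inj_if_eucl_det_nonzero:
  assumes f: "linear f" and det: "eucl_det f \<noteq> 0"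
  shows "inj f"
proof -
  define M where "M = (\<chi> i j. f (basis_enum j) \<bullet> basis_enum i)"
  have M: "M *v (\<chi> j. x \<bullet> basis_enum j) = (\<chi> i. f x \<bullet> basis_enum i)" for x
  proof -
    have "x = (\<Sum>j\<in>UNIV. (x \<bullet> basis_enum j) *\<^sub>R basis_enum j)"
      using from_coords_inner[of x] by (simp add: from_coords_def)
    then have "f x = (\<Sum>j\<in>UNIV. (x \<bullet> basis_enum j) *\<^sub>R f (basis_enum j))"
      using linear_sum[OF f, of "\<lambda>j. (x \<bullet> basis_enum j) *\<^sub>R basis_enum j" UNIV]
      by (simp add: linear_scale[OF f])
    then show ?thesis
      by (simp add: M_def matrix_vector_mult_def vec_eq_iff inner_sum_left mult.commute)
  qed
  have "invertible M" using det by (simp add: invertible_det_nz M_def eucl_det_def)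
  have "x = 0" if "f x = 0" for x
  proof -
    have "M *v (\<chi> j. x \<bullet> basis_enum j) = 0" using that by (simp add: M vec_eq_iff)
    then have "(\<chi> j. x \<bullet> basis_enum j) = 0"
      using \<open>invertible M\<close> matrix_left_invertible_ker[of M] unfolding invertible_def by blast
    then show ?thesis using from_coords_inner[of x] by (simp add: from_coords_def)
  qed
  then show ?thesis using f linear_injective_0 by blast
qed

subsection \<open>John's theorem over the real and complex field\<close>

lemma of_real_smult: "of_real r *s x = r *\<^sub>R (x :: 'k::real_normed_field ^ 'n)"
  by (simp add: vec_eq_iff scaleR_conv_of_real[where 'a = 'k])

text \<open>An abstract conjugation covers both fields: the identity on the reals and
  \<open>cnj\<close> on the complex numbers. The first axiom makes multiplication by
  \<open>cj a\<close> the real adjoint of multiplication by \<open>a\<close>.\<close>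

locale conjugation =
  fixes cj :: "'k::{real_normed_field, euclidean_space} \<Rightarrow> 'k"
  assumes inner_mult_left: "(a * x) \<bullet> y = x \<bullet> (cj a * y)"
    and mult_cj: "a * cj a = of_real ((norm a)\<^sup>2)"
begin

text \<open>The algebraic laws of \<open>cj\<close> below all rest on the uniqueness of adjoints,
  tested against every \<open>z\<close>.\<close>

lemma inner_ext: "(\<And>z::'k. z \<bullet> x = z \<bullet> y) \<Longrightarrow> x = y"
  by (metis inner_commute vector_eq_rdot)

lemma cj_add: "cj (a + b) = cj a + cj b"
proof (rule inner_ext)
  fix z
  have "z \<bullet> (cj (a + b) * 1) = z \<bullet> (cj a * 1) + z \<bullet> (cj b * 1)"
    unfolding inner_mult_left[symmetric] by (simp add: distrib_right inner_add_left)
  then show "z \<bullet> cj (a + b) = z \<bullet> (cj a + cj b)" by (simp add: inner_add_right)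
qed

lemma cj_mult: "cj (a * b) = cj a * cj b"
proof (rule inner_ext)
  fix z
  have "z \<bullet> (cj (a * b) * 1) = z \<bullet> (cj a * (cj b * 1))"
    unfolding inner_mult_left[symmetric] by (simp add: ac_simps)
  then show "z \<bullet> cj (a * b) = z \<bullet> (cj a * cj b)" by simp
qed

lemma cj_cj: "cj (cj a) = a"
proof (rule inner_ext)
  fix z
  have "z \<bullet> (cj (cj a) * 1) = z \<bullet> (a * 1)"
    unfolding inner_mult_left[symmetric] by (metis inner_commute inner_mult_left)
  then show "z \<bullet> cj (cj a) = z \<bullet> a" by simp
qed

lemma cj_of_real: "cj (of_real r) = of_real r"
proof (rule inner_ext)
  fix z
  have "z \<bullet> (cj (of_real r) * 1) = z \<bullet> (of_real r * 1)"
    unfolding inner_mult_left[symmetric] by (simp add: of_real_def)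
  then show "z \<bullet> cj (of_real r) = z \<bullet> of_real r" by simp
qed

lemma cj_0 [simp]: "cj 0 = 0" and cj_1 [simp]: "cj 1 = 1"
  using cj_of_real[of 0] cj_of_real[of 1] by simp_all

lemma norm_cj [simp]: "norm (cj a) = norm a"
proof (cases "a = 0")
  case False
  have "norm a * norm (cj a) = norm a * norm a"
    using arg_cong[OF mult_cj[of a], of norm] by (simp add: norm_mult power2_eq_square)
  then show ?thesis using False by simp
qed simp

lemma linear_cj: "linear cj"
  by (rule linearI) (simp_all add: cj_add cj_mult cj_of_real scaleR_conv_of_real)

lemma cj_sum: "cj (sum f A) = (\<Sum>a\<in>A. cj (f a))"
  using linear_sum[OF linear_cj] .

lemma cj_prod: "cj (prod f A) = (\<Prod>a\<in>A. cj (f a))"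
  by (induction A rule: infinite_finite_induct) (simp_all add: cj_mult)

lemma inner_eq_inner_one: "x \<bullet> y = (x * cj y) \<bullet> 1"
  using inner_mult_left[of "cj y" x 1] by (simp add: cj_cj mult.commute)

definition herm :: "'k ^ 'n::finite \<Rightarrow> 'k ^ 'n \<Rightarrow> 'k" where
  "herm x y = (\<Sum>i\<in>UNIV. x $ i * cj (y $ i))"

text \<open>Here \<open>\<bullet> 1\<close> acts as the real part, so the real inner product is the
  real part of the Hermitian form.\<close>

lemma inner_herm: "x \<bullet> y = herm x y \<bullet> 1"
  by (simp add: herm_def inner_vec_def inner_sum_left inner_eq_inner_one[of "x $ _"])

lemma herm_self: "herm x x = of_real ((norm x)\<^sup>2)"
proof -
  have "(norm x)\<^sup>2 = (\<Sum>i\<in>UNIV. (norm (x $ i))\<^sup>2)"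
    by (simp add: norm_vec_def L2_set_def sum_nonneg)
  then show ?thesis by (simp add: herm_def mult_cj)
qed

lemma cj_herm: "cj (herm x y) = herm y x"
  by (simp add: herm_def cj_sum cj_mult cj_cj mult.commute)

lemma herm_add_left: "herm (x + y) z = herm x z + herm y z"
  and herm_smult_left: "herm (a *s x) z = a * herm x z"
  and herm_sum_left: "herm (sum f A) z = (\<Sum>a\<in>A. herm (f a) z)"
  by (simp_all add: herm_def distrib_right sum.distrib sum_distrib_left mult.assoc
      sum_distrib_right sum.swap[of _ A])

lemma norm_herm_eq_inner:
  obtains a where "norm a = 1" "norm (herm x y) = (a *s x) \<bullet> y"
proof (cases "herm x y = 0")
  case True
  then show ?thesis using that[of 1] by (simp add: inner_herm)
next
  case False
  define a where "a = cj (herm x y) / of_real (norm (herm x y))"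
  have "norm a = 1" using False by (simp add: a_def norm_divide)
  moreover have "herm (a *s x) y = of_real (norm (herm x y))"
    using False by (simp add: herm_smult_left a_def mult.commute mult_cj power2_eq_square)
  then have "(a *s x) \<bullet> y = norm (herm x y)"
    by (simp add: inner_herm of_real_def dot_square_norm)
  ultimately show ?thesis using that by metis
qed

definition outer :: "'k ^ 'n::finite \<Rightarrow> 'k ^ 'n ^ 'n" where
  "outer v = (\<chi> i j. v $ i * cj (v $ j))"

lemma outer_mult_vec: "outer v *v x = herm x v *s v"
  by (simp add: outer_def herm_def matrix_vector_mult_def vec_eq_iff sum_distrib_left
      mult.commute mult.left_commute)

text \<open>Turns a separating hyperplane in the space of matrices into an inequality between
  quadratic forms on the vectors \<open>v\<close>.\<close>

lemma inner_outer: "A \<bullet> outer v = (A *v v) \<bullet> v"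
proof -
  have "A $ i $ j \<bullet> (v $ i * cj (v $ j)) = (A $ i $ j * v $ j) \<bullet> v $ i" for i j
    using inner_mult_left[of "v $ j" "A $ i $ j" "v $ i"] by (simp add: mult.commute)
  then show ?thesis
    by (simp add: inner_vec_def outer_def matrix_vector_mult_def inner_sum_left)
qed

lemma sum_Basis_vec:
  "(\<Sum>b\<in>(Basis :: ('k ^ 'n::finite) set). g b) = (\<Sum>i\<in>UNIV. \<Sum>u\<in>Basis. g (axis i u))"
proof -
  have "(\<Sum>b\<in>(Basis :: ('k ^ 'n::finite) set). g b) =
      (\<Sum>i\<in>UNIV. sum g ((\<lambda>u. axis i u) ` Basis))"
    unfolding Basis_vec_def
    by (subst sum.UNION_disjoint[symmetric])
      (auto simp: axis_eq_axis nonzero_Basis intro!: sum.cong)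
  then show ?thesis
    by (simp add: sum.reindex inj_on_def axis_eq_axis)
qed

text \<open>The left side is the trace of \<open>A\<close> as a real-linear map. It exceeds the real
  part of the trace over the field, which is \<open>A \<bullet> mat 1\<close>, by the factor
  \<open>DIM('k)\<close>.\<close>

lemma trace_matrix_vector:
  "(\<Sum>b\<in>Basis. (A *v b) \<bullet> b) = DIM('k) * (A \<bullet> (mat 1 :: 'k ^ 'n ^ 'n::finite))"
proof -
  have u: "(a * u) \<bullet> u = a \<bullet> 1" if "u \<in> Basis" for a u :: 'k
  proof -
    have "(a * u) \<bullet> u = a \<bullet> (u * cj u)"
      using inner_mult_left[of u a u] by (simp add: mult.commute)
    then show ?thesis using that by (simp add: mult_cj)
  qed
  have "(\<Sum>b\<in>Basis. (A *v b) \<bullet> b) = (\<Sum>i\<in>UNIV. \<Sum>u\<in>Basis. (A *v axis i u) \<bullet> axis i u)"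
    by (rule sum_Basis_vec)
  also have "\<dots> = (\<Sum>i\<in>UNIV. \<Sum>u\<in>Basis. (A $ i $ i * u) \<bullet> u)"
    by (simp add: inner_axis) (simp add: matrix_vector_mult_def axis_def if_distrib cong: if_cong)
  also have "\<dots> = (\<Sum>i\<in>UNIV. \<Sum>u\<in>(Basis :: 'k set). A $ i $ i \<bullet> 1)"
    by (simp add: u)
  also have "\<dots> = DIM('k) * (\<Sum>i\<in>UNIV. A $ i $ i \<bullet> 1)"
    by (simp add: sum_distrib_left)
  also have "(\<Sum>i\<in>UNIV. A $ i $ i \<bullet> 1) = A \<bullet> mat 1"
    by (simp add: inner_vec_def mat_def if_distrib[of "\<lambda>x. _ \<bullet> x"] cong: if_cong)
  finally show ?thesis .
qed

lemma linear_matrix_vector: "linear ((*v) (A :: 'k ^ 'n ^ 'm))"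
  by (rule linearI)
    (simp_all add: matrix_vector_right_distrib matrix_vector_mult_def[of A "_ *\<^sub>R _"]
      matrix_vector_mult_def[of A] vec_eq_iff scaleR_sum_right)

text \<open>Taking traces shows that \<open>r\<close> is the \<open>b\<close>-average of the squared
  norms of the vectors in \<open>S\<close>. The weights are normalised to sum 1 so that they are
  probability weights in the Cauchy-Schwarz step.\<close>

definition tight_frame :: "('k ^ 'n::finite) set \<Rightarrow> ('k ^ 'n \<Rightarrow> real) \<Rightarrow> real \<Rightarrow> bool" where
  "tight_frame S b r \<longleftrightarrow> finite S \<and> (\<forall>v\<in>S. 0 \<le> b v) \<and> sum b S = 1 \<and>
     (\<forall>x. (\<Sum>v\<in>S. (of_real (b v) * herm x v) *s v) = of_real (r / CARD('n)) *s x)"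

text \<open>The hypothesis \<open>opt\<close> says that the unit ball has least volume among the
  centred ellipsoids containing \<open>K\<close>. If the identity divided by n were not an average
  of rank one operators from \<open>K\<close>, a separating matrix \<open>A\<close> would give a
  perturbation of the identity whose determinant grows, to first order, faster than the norms on
  \<open>K\<close> allow.\<close>

lemma john_decomposition:
  fixes K :: "('k ^ 'n::finite) set"
  assumes K: "compact K" "K \<subseteq> cball 0 1"
    and opt: "\<And>R. Vector_Spaces.linear (*s) (*s) R \<Longrightarrow> (\<And>v. v \<in> K \<Longrightarrow> norm (R v) \<le> 1) \<Longrightarrow>
      \<bar>eucl_det R\<bar> \<le> 1"
  obtains S b where "S \<subseteq> K" "tight_frame S b 1"
proof -
  define Id where "Id = (1 / CARD('n)) *\<^sub>R (mat 1 :: 'k ^ 'n ^ 'n)"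
  have "continuous_on K outer"
    unfolding outer_def
    by (intro continuous_intros linear_continuous_on_compose[OF _ linear_cj])
  then have cpt: "compact (convex hull (outer ` K))"
    using K by (intro compact_convex_hull compact_continuous_image)
  have "Id \<in> convex hull (outer ` K)"
  proof (rule ccontr)
    assume "Id \<notin> convex hull (outer ` K)"
    then obtain a b where ab: "a \<bullet> Id < b" "\<And>x. x \<in> convex hull (outer ` K) \<Longrightarrow> b < a \<bullet> x"
      using separating_hyperplane_closed_point[OF convex_convex_hull compact_imp_closed[OF cpt]]
      by metis
    define A where "A = - a"
    have A_Id: "A \<bullet> Id > - b" using ab by (simp add: A_def)
    have A_K: "(A *v v) \<bullet> v < - b" if "v \<in> K" for v
      using ab(2)[of "outer v"] that hull_inc[of "outer v" "outer ` K"]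
      by (simp add: A_def inner_outer[symmetric])
    obtain B where B: "B > 0" "\<And>x. norm (A *v x) \<le> B * norm x"
      using linear_bounded_pos[OF linear_matrix_vector] by metis
    define D where "D = DIM('k ^ 'n)"
    have D: "D > 0" "real D = CARD('n) * DIM('k)" by (simp_all add: D_def)
    \<comment> \<open>For positive \<open>e\<close>, \<open>q e\<close> bounds the squared norm of v
      + e A v over \<open>K\<close>: its terms come from norm v <= 1, from the separation inequality
      and from the norm bound \<open>B\<close>.\<close>
    define q where "q e = 1 - 2 * e * b + e\<^sup>2 * B\<^sup>2" for e
    define p where "p e = eucl_det (\<lambda>x. x + e *\<^sub>R (A *v x))" for e
    have p0: "p 0 = 1"
    proof -
      have "(\<chi> i j. basis_enum j \<bullet> basis_enum i) = (mat 1 :: real ^ ('k ^ 'n) basis_index ^ _)"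
        by (auto simp: vec_eq_iff mat_def inner_basis_enum)
      then show ?thesis by (simp add: p_def eucl_det_def)
    qed
    \<comment> \<open>The trace of \<open>A\<close> over the reals is D times
      \<open>A \<bullet> Id\<close> because \<open>Id\<close> already carries the factor 1 /
      n.\<close>
    have p': "(p has_real_derivative D * (A \<bullet> Id)) (at 0)"
      using has_derivative_eucl_det_perturbation[of "(*v) A"]
      unfolding p_def trace_matrix_vector by (simp add: D Id_def)
    have q': "(q has_real_derivative - 2 * b) (at 0)"
      unfolding q_def by (auto intro!: derivative_eq_intros)
    \<comment> \<open>The difference vanishes at 0 and decreases there, so for small
      \<open>e\<close> the squared determinant exceeds \<open>q e ^ D\<close>. Dividing the
      perturbation by \<open>sqrt (q e)\<close> keeps \<open>K\<close> in the unit ball but leaves a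
      determinant above 1, against \<open>opt\<close>.\<close>
    have "((\<lambda>e. q e ^ D - (p e)\<^sup>2) has_real_derivative - 2 * D * (A \<bullet> Id + b)) (at 0)"
      by (rule derivative_eq_intros refl p' q')+ (simp add: p0 q_def algebra_simps)
    moreover have "- 2 * D * (A \<bullet> Id + b) < 0"
      using D(1) A_Id by (simp add: mult_less_0_iff)
    ultimately have "\<exists>d>0. \<forall>h>0. h < d \<longrightarrow> q 0 ^ D - (p 0)\<^sup>2 > q (0 + h) ^ D - (p (0 + h))\<^sup>2"
      by (rule DERIV_neg_dec_right)
    then obtain d where d: "d > 0" "\<And>h. 0 < h \<Longrightarrow> h < d \<Longrightarrow> q h ^ D - (p h)\<^sup>2 < 0"
      by (auto simp: p0 q_def)
    have "isCont q 0" using q' DERIV_isCont by blast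
    then have "(q \<longlongrightarrow> 1) (at 0)" by (simp add: isCont_def q_def)
    then have "eventually (\<lambda>e. q e > 0) (at 0)"
      by (rule order_tendstoD) simp
    then obtain d' where d': "d' > 0" "\<And>e. e \<noteq> 0 \<Longrightarrow> \<bar>e\<bar> < d' \<Longrightarrow> q e > 0"
      by (auto simp: eventually_at dist_real_def)
    define e where "e = min d d' / 2"
    have e: "e > 0" "e < d" "e < d'" using d d' by (auto simp: e_def)
    have qe: "q e > 0" using d' e by auto
    define R where "R x = (1 / sqrt (q e)) *\<^sub>R (x + e *\<^sub>R (A *v x))" for x
    have "Vector_Spaces.linear (*s) (*s) R"
      unfolding R_def linear_iff vec.vector_space_axioms
      using vec.vector_space_axioms
      by (auto simp: Vector_Spaces.linear_iff matrix_vector_right_distrib matrix_vector_mult_scaleR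
          vector_scalar_commute scaleR_add_right algebra_simps vec_eq_iff)
    moreover have "norm (R v) \<le> 1" if v: "v \<in> K" for v
    proof -
      have nv: "norm v \<le> 1" using K v by auto
      have "(norm (v + e *\<^sub>R (A *v v)))\<^sup>2 = (norm v)\<^sup>2 + 2 * e * ((A *v v) \<bullet> v) + e\<^sup>2 * (norm (A *v v))\<^sup>2"
        by (simp add: power2_norm_eq_inner inner_add inner_commute algebra_simps)
          (simp add: power2_eq_square)
      also have "\<dots> \<le> 1 + 2 * e * (- b) + e\<^sup>2 * B\<^sup>2"
      proof (intro add_mono mult_left_mono)
        show "(norm v)\<^sup>2 \<le> 1" using nv by (simp add: power_le_one)
        show "(A *v v) \<bullet> v \<le> - b" using A_K[OF v] by simp
        have "norm (A *v v) \<le> B" using order_trans[OF B(2)[of v] mult_left_mono[OF nv, of B]] B(1) by simp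
        then show "(norm (A *v v))\<^sup>2 \<le> B\<^sup>2" by (simp add: power_mono)
      qed (use e in auto)
      finally have "(norm (v + e *\<^sub>R (A *v v)))\<^sup>2 \<le> q e" by (simp add: q_def)
      then show ?thesis
        using qe by (simp add: R_def real_le_rsqrt)
    qed
    ultimately have "\<bar>eucl_det R\<bar> \<le> 1" by (rule opt)
    moreover have "eucl_det R = (1 / sqrt (q e)) ^ D * p e"
      unfolding R_def p_def D_def by (rule eucl_det_scaleR)
    ultimately have "((1 / sqrt (q e)) ^ D * p e)\<^sup>2 \<le> 1"
      by (metis abs_square_le_1)
    moreover have "((1 / sqrt (q e)) ^ D * p e)\<^sup>2 = (p e)\<^sup>2 / q e ^ D"
    proof -
      have "((1 / sqrt (q e)) ^ D * p e)\<^sup>2 = ((1 / sqrt (q e))\<^sup>2) ^ D * (p e)\<^sup>2"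
        by (simp only: power_mult_distrib power_mult[symmetric] mult.commute[of 2 D])
      also have "(1 / sqrt (q e))\<^sup>2 = 1 / q e" using qe by (simp add: power_divide)
      finally show ?thesis by (simp add: power_one_over field_simps)
    qed
    ultimately show False
      using d(2)[OF e(1,2)] qe by (simp add: divide_le_eq)
  qed
  then obtain Y u where Y: "finite Y" "Y \<subseteq> outer ` K" "\<And>y. y \<in> Y \<Longrightarrow> 0 \<le> u y" "sum u Y = 1"
    "(\<Sum>y\<in>Y. u y *\<^sub>R y) = Id"
    unfolding convex_hull_explicit mem_Collect_eq by blast
  \<comment> \<open>\<open>outer\<close> forgets a unimodular factor of the vector, so one preimage
    in \<open>K\<close> is chosen for each rank one matrix.\<close>
  define g where "g y = (SOME v. v \<in> K \<and> outer v = y)" for y :: "'k ^ 'n ^ 'n"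
  have g: "g y \<in> K \<and> outer (g y) = y" if "y \<in> Y" for y
    unfolding g_def by (rule someI_ex) (use Y(2) that in auto)
  have inj: "inj_on g Y" by (rule inj_on_inverseI[of _ outer]) (use g in blast)
  have "(\<Sum>v\<in>g ` Y. (of_real (u (outer v)) * herm x v) *s v) = of_real (1 / CARD('n)) *s x" for x
  proof -
    have "(\<Sum>v\<in>g ` Y. (of_real (u (outer v)) * herm x v) *s v) = (\<Sum>y\<in>Y. u y *\<^sub>R (y *v x))"
      unfolding sum.reindex[OF inj]
    proof (rule sum.cong)
      fix y assume y: "y \<in> Y"
      have "y *v x = herm x (g y) *s g y" using g[OF y] outer_mult_vec by metis
      then show "((\<lambda>v. (of_real (u (outer v)) * herm x v) *s v) \<circ> g) y = u y *\<^sub>R (y *v x)"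
        using g[OF y] by (simp only: o_def vec.scale_scale[symmetric] of_real_smult)
    qed simp
    also have "\<dots> = (\<Sum>y\<in>Y. u y *\<^sub>R y) *v x"
      by (simp add: vec_eq_iff matrix_vector_mult_def scaleR_sum_right sum_distrib_right
          sum.swap[of _ Y])
    also have "\<dots> = (1 / CARD('n)) *\<^sub>R (mat 1 *v x)"
      unfolding Y(5) Id_def
      by (simp add: vec_eq_iff matrix_vector_mult_def scaleR_sum_right)
    also have "\<dots> = of_real (1 / CARD('n)) *s x"
      by (simp only: of_real_smult matrix_vector_mul_lid)
    finally show ?thesis .
  qed
  moreover have "sum (\<lambda>v. u (outer v)) (g ` Y) = 1"
    using Y(4) g by (simp add: sum.reindex[OF inj])
  ultimately have "tight_frame (g ` Y) (\<lambda>v. u (outer v)) 1"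
    using Y(1,3) g by (auto simp: tight_frame_def)
  moreover have "g ` Y \<subseteq> K" using g by blast
  ultimately show ?thesis using that by blast
qed

end

subsection \<open>Volume extremality and the Banach--Mazur distance\<close>

lemma vector_space_linearD:
  assumes "Vector_Spaces.linear s1 s2 f"
  shows "f (x + y) = f x + f y" "f (s1 a x) = s2 a (f x)" "f (x - y) = f x - f y" "f 0 = 0"
    "f (sum g A) = (\<Sum>i\<in>A. f (g i))"
proof -
  interpret Vector_Spaces.linear s1 s2 f by fact
  show "f (x + y) = f x + f y" "f (s1 a x) = s2 a (f x)" "f (x - y) = f x - f y" "f 0 = 0"
    "f (sum g A) = (\<Sum>i\<in>A. f (g i))"
    by (rule add scale diff zero sum)+
qed

lemma vector_space_linear_inv:
  assumes lin: "Vector_Spaces.linear s1 s2 f" and "bij f"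
  shows "Vector_Spaces.linear s2 s1 (inv f)"
proof -
  have f: "f (inv f y) = y" "inv f (f x) = x" for x y
    using assms(2) by (simp_all add: bij_is_surj surj_f_inv_f bij_is_inj)
  have "inv f (x + y) = inv f x + inv f y" for x y
    using f(2)[of "inv f x + inv f y"] by (simp add: vector_space_linearD[OF lin] f(1))
  moreover have "inv f (s2 a x) = s1 a (inv f x)" for a x
    using f(2)[of "s1 a (inv f x)"] by (simp add: vector_space_linearD[OF lin] f(1))
  ultimately show ?thesis
    using lin by (simp add: Vector_Spaces.linear_iff)
qed

lemma linear_vec_imp_real_linear:
  fixes R :: "'k::real_normed_field ^ 'n \<Rightarrow> 'k ^ 'm"
  assumes "Vector_Spaces.linear (*s) (*s) R"
  shows "linear R"
  by (rule linearI) (simp_all add: vector_space_linearD[OF assms] flip: of_real_smult)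

lemma measure_lebesgue_scaleR:
  fixes S :: "'a::euclidean_space set"
  shows "measure lebesgue ((*\<^sub>R) r ` S) = \<bar>r\<bar> ^ DIM('a) * measure lebesgue S"
  using measure_lebesgue_affine[of r 0 S] by simp

text \<open>The coordinates \<open>T\<close> send \<open>cball 0 1\<close> to the John and
  \<open>cball 0 c\<close> to the Loewner ellipsoid. \<open>N_T_le\<close> and
  \<open>norm_le\<close> are the two inclusions, \<open>john\<close> and \<open>loewner\<close> the
  extremality of the volumes measured in these coordinates.\<close>

locale proportional_ellipsoids = conjugation cj + normed_space smul N
  for cj :: "'k::{real_normed_field, euclidean_space} \<Rightarrow> 'k"
    and smul :: "'k \<Rightarrow> 'a::ab_group_add \<Rightarrow> 'a" and N +
  fixes T :: "'k ^ 'n::finite \<Rightarrow> 'a" and c :: real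
  assumes linear_T: "Vector_Spaces.linear (*s) smul T" and bij_T: "bij T"
    and c_pos: "0 < c"
    and N_T_le: "N (T x) \<le> norm x"
    and norm_le: "norm x \<le> c * N (T x)"
    and john: "ellipsoid TYPE('n) smul E \<Longrightarrow> E \<subseteq> unit_ball N \<Longrightarrow>
      measure lebesgue (T -` E) \<le> measure lebesgue (cball (0 :: 'k ^ 'n) 1)"
    and loewner: "ellipsoid TYPE('n) smul E \<Longrightarrow> unit_ball N \<subseteq> E \<Longrightarrow>
      measure lebesgue (cball (0 :: 'k ^ 'n) c) \<le> measure lebesgue (T -` E)"
begin

lemmas T_simps = vector_space_linearD[OF linear_T]

lemma T_inv [simp]: "T (inv T x) = x" "inv T (T y) = y"
  using bij_T by (simp_all add: bij_is_surj surj_f_inv_f bij_is_inj)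

lemma linear_inv_T: "Vector_Spaces.linear smul (*s) (inv T)"
  using linear_T bij_T by (rule vector_space_linear_inv)

lemmas inv_T_simps = vector_space_linearD[OF linear_inv_T]

definition C :: "('k ^ 'n) set" where
  "C = {x. N (T x) \<le> 1}"

lemma continuous_N_T: "continuous_on S (\<lambda>x. N (T x))"
proof -
  have *: "N (T x) - N (T y) \<le> dist x y" for x y
    using norm_triangle[of "T (x - y)" "T y"] N_T_le[of "x - y"]
    by (simp add: dist_norm T_simps flip: T_simps(1))
  then have "dist (N (T x)) (N (T y)) \<le> dist x y" for x y
    using *[of x y] *[of y x] by (simp add: dist_real_def abs_le_iff dist_commute)
  then show ?thesis
    unfolding continuous_on_iff by (meson le_less_trans)
qed

lemma compact_C: "compact C" and convex_C: "convex C" and cball_subset_C: "cball 0 1 \<subseteq> C"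
  and C_subset_cball: "C \<subseteq> cball 0 c"
proof -
  show sub: "C \<subseteq> cball 0 c"
  proof
    fix x assume "x \<in> C"
    then have "c * N (T x) \<le> c * 1" using c_pos by (intro mult_left_mono) (auto simp: C_def)
    then show "x \<in> cball 0 c" using norm_le[of x] by simp
  qed
  have "closed C"
    unfolding C_def using continuous_N_T[of UNIV] by (intro closed_Collect_le) auto
  then show "compact C"
    using sub bounded_subset[OF bounded_cball] compact_eq_bounded_closed by blast
  show "cball 0 1 \<subseteq> C"
  proof
    fix x :: "'k ^ 'n" assume "x \<in> cball 0 1"
    then show "x \<in> C" using N_T_le[of x] by (simp add: C_def)
  qed
  show "convex C"
  proof (rule convexI)
    fix x y and u v :: real
    assume xy: "x \<in> C" "y \<in> C" and uv: "0 \<le> u" "0 \<le> v" "u + v = 1"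
    have "N (T (u *\<^sub>R x + v *\<^sub>R y)) \<le> u * N (T x) + v * N (T y)"
      using norm_triangle[of "smul (of_real u) (T x)" "smul (of_real v) (T y)"] uv
      by (simp add: T_simps norm_scale flip: of_real_smult)
    also have "\<dots> \<le> u * 1 + v * 1" using xy uv by (intro add_mono mult_left_mono) (auto simp: C_def)
    finally show "u *\<^sub>R x + v *\<^sub>R y \<in> C" using uv by (simp add: C_def)
  qed
qed

lemma C_smult: "x \<in> C \<Longrightarrow> norm a = 1 \<Longrightarrow> a *s x \<in> C"
  by (simp add: C_def T_simps norm_scale)

lemma ellipsoid_T_comp:
  fixes R :: "'k ^ 'n \<Rightarrow> 'k ^ 'n"
  assumes "Vector_Spaces.linear (*s) (*s) R"
  shows "ellipsoid TYPE('n) smul (T ` R ` cball 0 1)" "T -` (T ` R ` cball 0 1) = R ` cball 0 1"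
proof -
  have "Vector_Spaces.linear (*s) smul (T \<circ> R)"
    using Vector_Spaces.linear_compose[OF assms linear_T] .
  then show "ellipsoid TYPE('n) smul (T ` R ` cball 0 1)"
    unfolding ellipsoid_def by (intro exI[of _ "T \<circ> R"]) (simp add: image_comp)
  show "T -` (T ` R ` cball 0 1) = R ` cball 0 1"
    using bij_T by (simp add: bij_is_inj inj_vimage_image_eq)
qed

lemma ball_measure_pos: "0 < measure lebesgue (cball (0 :: 'k ^ 'n) 1)"
  by (simp add: content_cball_pos)

text \<open>The preimage of \<open>cball 0 c\<close> under \<open>R\<close> is an ellipsoid
  containing \<open>C\<close>, so its volume is at least that of \<open>cball 0 c\<close>. Arguing
  by contradiction supplies the invertibility of \<open>R\<close>.\<close>

lemma loewner_det_le:
  fixes R :: "'k ^ 'n \<Rightarrow> 'k ^ 'n"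
  assumes R: "Vector_Spaces.linear (*s) (*s) R" and le: "\<And>v. v \<in> C \<Longrightarrow> norm (R v) \<le> c"
  shows "\<bar>eucl_det R\<bar> \<le> 1"
proof (rule ccontr)
  assume "\<not> \<bar>eucl_det R\<bar> \<le> 1"
  then have gt: "\<bar>eucl_det R\<bar> > 1" by simp
  have lin: "linear R" using R by (rule linear_vec_imp_real_linear)
  have "inj R" using gt lin by (intro inj_if_eucl_det_nonzero) auto
  then have "bij R" using lin linear_injective_imp_surjective by (auto simp: bij_def)
  then have R_inv: "R (inv R x) = x" "inv R (R x) = x" for x
    by (simp_all add: bij_is_surj surj_f_inv_f bij_is_inj)
  have lin_inv: "Vector_Spaces.linear (*s) (*s) (inv R)"
    using R \<open>bij R\<close> by (rule vector_space_linear_inv)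
  define S where "S x = of_real c *s inv R x" for x
  have S: "Vector_Spaces.linear (*s) (*s) S"
    using lin_inv unfolding S_def Vector_Spaces.linear_iff
    by (simp add: vec.scale_right_distrib vec.scale_left_commute)
  have S_eq: "S ` cball 0 1 = (*\<^sub>R) c ` inv R ` cball 0 1"
    by (simp add: S_def image_image of_real_smult)
  have cpt: "compact (inv R ` cball 0 1)"
    using linear_vec_imp_real_linear[OF lin_inv]
    by (intro compact_continuous_image compact_cball linear_continuous_on)
      (simp add: linear_conv_bounded_linear)
  have "unit_ball N \<subseteq> T ` S ` cball 0 1"
  proof
    fix x assume "x \<in> unit_ball N"
    then have "inv T x \<in> C" by (simp add: C_def unit_ball_def)
    then have "norm (R (inv T x)) \<le> c" by (rule le)
    then have w: "(1 / c) *\<^sub>R R (inv T x) \<in> cball 0 1" using c_pos by (simp add: field_simps)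
    have "S ((1 / c) *\<^sub>R R (inv T x)) = inv T x"
      using c_pos linear_scale[OF linear_vec_imp_real_linear[OF lin_inv]]
      by (simp add: S_def of_real_smult R_inv)
    then show "x \<in> T ` S ` cball 0 1" using w by (metis T_inv(1) imageI)
  qed
  then have "measure lebesgue (cball (0 :: 'k ^ 'n) c) \<le> measure lebesgue (S ` cball 0 1)"
    using loewner ellipsoid_T_comp[OF S] by metis
  moreover have "cball (0 :: 'k ^ 'n) c = (*\<^sub>R) c ` cball 0 1"
    using c_pos by (simp add: cball_scale)
  ultimately have "measure lebesgue (cball (0 :: 'k ^ 'n) 1) \<le> measure lebesgue (inv R ` cball 0 1)"
    unfolding S_eq using c_pos by (simp add: measure_lebesgue_scaleR)
  moreover have "measure lebesgue (cball (0 :: 'k ^ 'n) 1) =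
      \<bar>eucl_det R\<bar> * measure lebesgue (inv R ` cball 0 1)"
    using measure_linear_image_compact[OF lin cpt] by (simp add: image_image R_inv)
  ultimately show False
    using gt ball_measure_pos mult_strict_right_mono[OF gt, of "measure lebesgue (inv R ` cball 0 1)"]
    by (simp add: zero_less_mult_iff not_le[symmetric])
qed

text \<open>The polar is taken for the real inner product, so that real separation applies. Since
  \<open>C\<close> is invariant under unimodular scalars, its points also give scalar-valued
  functionals of dual norm at most 1, see \<open>herm_in_dual_unit_ball\<close>.\<close>

definition polar_C :: "('k ^ 'n) set" where
  "polar_C = {y. \<forall>x\<in>C. x \<bullet> y \<le> 1}"

lemma compact_polar_C: "compact polar_C" and polar_C_subset: "polar_C \<subseteq> cball 0 1"
proof -
  show sub: "polar_C \<subseteq> cball 0 1"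
  proof
    fix y assume y: "y \<in> polar_C"
    have "sgn y \<in> C" using cball_subset_C by (auto simp: norm_sgn)
    then have "sgn y \<bullet> y \<le> 1" using y by (auto simp: polar_C_def)
    then show "y \<in> cball 0 1"
      by (cases "y = 0") (simp_all add: sgn_div_norm dot_square_norm power2_eq_square field_simps)
  qed
  have "polar_C = (\<Inter>x\<in>C. {y. x \<bullet> y \<le> 1})" by (auto simp: polar_C_def)
  then have "closed polar_C" by (auto simp: closed_halfspace_le)
  then show "compact polar_C"
    using sub bounded_subset[OF bounded_cball] compact_eq_bounded_closed by blast
qed

lemma bipolar: "x \<in> C" if "\<And>y. y \<in> polar_C \<Longrightarrow> x \<bullet> y \<le> 1"
proof (rule ccontr)
  assume "x \<notin> C"
  then obtain a b where ab: "a \<bullet> x < b" "\<And>z. z \<in> C \<Longrightarrow> b < a \<bullet> z"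
    using separating_hyperplane_closed_point[OF convex_C compact_imp_closed[OF compact_C]] by metis
  have "0 \<in> C" using cball_subset_C by force
  then have b: "b < 0" using ab(2)[of 0] by simp
  have "z \<bullet> ((1 / b) *\<^sub>R a) \<le> 1" if "z \<in> C" for z
    using ab(2)[OF that] b by (simp add: inner_commute field_simps)
  then have "x \<bullet> ((1 / b) *\<^sub>R a) \<le> 1" by (intro that) (simp add: polar_C_def)
  then show False using ab(1) b by (simp add: inner_commute field_simps)
qed

text \<open>By duality \<open>adjoint R\<close> maps the unit ball into \<open>C\<close>, so its
  image competes with the John ellipsoid, and it has the same determinant as \<open>R\<close>. The
  maximal volume problem for \<open>C\<close> thereby becomes a minimal volume problem for
  \<open>polar_C\<close>, to which \<open>john_decomposition\<close> applies.\<close>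

lemma john_det_le:
  fixes R :: "'k ^ 'n \<Rightarrow> 'k ^ 'n"
  assumes R: "Vector_Spaces.linear (*s) (*s) R" and le: "\<And>v. v \<in> polar_C \<Longrightarrow> norm (R v) \<le> 1"
  shows "\<bar>eucl_det R\<bar> \<le> 1"
proof -
  have lin: "linear R" using R by (rule linear_vec_imp_real_linear)
  have inner_smult: "(a *s x) \<bullet> y = x \<bullet> (cj a *s y)" for a and x y :: "'k ^ 'n"
    by (simp add: inner_vec_def inner_mult_left)
  \<comment> \<open>\<open>adjoint\<close> refers to the real inner product only. Linearity over the
    field has to be checked before its image of the ball counts as an ellipsoid.\<close>
  have adj_smult: "adjoint R (a *s y) = a *s adjoint R y" for a y
  proof -
    have "x \<bullet> adjoint R (a *s y) = x \<bullet> (a *s adjoint R y)" for x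
    proof -
      have "x \<bullet> adjoint R (a *s y) = (cj a *s R x) \<bullet> y"
        using inner_smult[of "cj a"] by (simp add: adjoint_works[OF lin] cj_cj)
      also have "\<dots> = x \<bullet> (a *s adjoint R y)"
        using inner_smult[of "cj a" x "adjoint R y"]
        by (simp add: adjoint_works[OF lin] cj_cj vector_space_linearD(2)[OF R])
      finally show ?thesis .
    qed
    then show ?thesis by (metis inner_commute vector_eq_rdot)
  qed
  have adj: "Vector_Spaces.linear (*s) (*s) (adjoint R)"
    using linear_add[OF adjoint_linear[OF lin]] adj_smult
    by (simp add: Vector_Spaces.linear_iff vec.vector_space_axioms)
  have "adjoint R ` cball 0 1 \<subseteq> C"
  proof safe
    fix w :: "'k ^ 'n" assume w: "w \<in> cball 0 1"
    show "adjoint R w \<in> C"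
    proof (rule bipolar)
      fix y assume y: "y \<in> polar_C"
      have "adjoint R w \<bullet> y = R y \<bullet> w"
        using adjoint_works[OF lin, of y w] by (simp add: inner_commute)
      also have "\<dots> \<le> norm (R y) * norm w" by (rule norm_cauchy_schwarz)
      also have "\<dots> \<le> 1" using le[OF y] w by (simp add: mult_le_one)
      finally show "adjoint R w \<bullet> y \<le> 1" .
    qed
  qed
  then have "T ` adjoint R ` cball 0 1 \<subseteq> unit_ball N"
    by (force simp: C_def unit_ball_def)
  then have "measure lebesgue (adjoint R ` cball 0 1) \<le> measure lebesgue (cball (0 :: 'k ^ 'n) 1)"
    using john ellipsoid_T_comp[OF adj] by metis
  then show ?thesis
    using measure_linear_image_compact[OF adjoint_linear[OF lin] compact_cball, of 0 1]
      ball_measure_pos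
    by (simp add: eucl_det_adjoint[OF lin] mult_le_cancel_right1)
qed

lemma john_functionals:
  obtains S b where "S \<subseteq> polar_C" "tight_frame S b 1"
  using john_decomposition[OF compact_polar_C polar_C_subset john_det_le] by blast

lemma loewner_vectors:
  obtains S b where "S \<subseteq> C" "tight_frame S b (c\<^sup>2)"
proof -
  define K where "K = (*\<^sub>R) (1 / c) ` C"
  have K1: "compact K" unfolding K_def by (rule compact_scaling[OF compact_C])
  have K2: "K \<subseteq> cball 0 1" using C_subset_cball c_pos by (force simp: K_def field_simps)
  have K3: "\<bar>eucl_det R\<bar> \<le> 1"
    if R: "Vector_Spaces.linear (*s) (*s) R" and le: "\<And>v. v \<in> K \<Longrightarrow> norm (R v) \<le> 1" for R
  proof (rule loewner_det_le[OF R])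
    fix v assume "v \<in> C"
    then have "norm (R ((1 / c) *\<^sub>R v)) \<le> 1" by (intro le) (auto simp: K_def)
    then show "norm (R v) \<le> c"
      using c_pos by (simp add: linear_scale[OF linear_vec_imp_real_linear[OF R]] field_simps)
  qed
  obtain S b where S: "S \<subseteq> K" and fr: "tight_frame S b 1"
    using john_decomposition[OF K1 K2 K3] by blast
  have inj: "inj_on ((*\<^sub>R) c) S" using c_pos by (auto simp: inj_on_def)
  \<comment> \<open>Replacing v by c v multiplies each rank one term by c^2, with unchanged weights.
    Hence the constant of the frame changes from 1 to c^2.\<close>
  have herm_scale: "herm x (of_real c *s v) = of_real c * herm x v" for x v :: "'k ^ 'n"
    by (simp add: herm_def cj_mult cj_of_real sum_distrib_left mult.left_commute)
  have "(\<Sum>v\<in>(*\<^sub>R) c ` S. (of_real (b ((1 / c) *\<^sub>R v)) * herm x v) *s v) =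
      of_real (c\<^sup>2 / CARD('n)) *s x" for x
  proof -
    have "(\<Sum>v\<in>(*\<^sub>R) c ` S. (of_real (b ((1 / c) *\<^sub>R v)) * herm x v) *s v) =
        (\<Sum>v\<in>S. of_real (c\<^sup>2) *s ((of_real (b v) * herm x v) *s v))"
      unfolding sum.reindex[OF inj] o_def
    proof (rule sum.cong)
      fix v assume "v \<in> S"
      have v: "(1 / c) *\<^sub>R c *\<^sub>R v = v" using c_pos by simp
      show "(of_real (b ((1 / c) *\<^sub>R c *\<^sub>R v)) * herm x (c *\<^sub>R v)) *s c *\<^sub>R v =
          of_real (c\<^sup>2) *s ((of_real (b v) * herm x v) *s v)"
        unfolding v of_real_smult[symmetric]
          by (simp add: herm_scale power2_eq_square mult_ac)
    qed simp
    also have "\<dots> = of_real (c\<^sup>2) *s (of_real (1 / CARD('n)) *s x)"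
      using fr by (simp only: tight_frame_def vec.scale_sum_right[symmetric])
    finally show ?thesis by simp
  qed
  moreover have "(\<Sum>v\<in>(*\<^sub>R) c ` S. b ((1 / c) *\<^sub>R v)) = 1"
    using fr c_pos by (simp add: tight_frame_def sum.reindex[OF inj])
  ultimately have "tight_frame ((*\<^sub>R) c ` S) (\<lambda>v. b ((1 / c) *\<^sub>R v)) (c\<^sup>2)"
    using fr c_pos by (auto simp: tight_frame_def)
  moreover have "(*\<^sub>R) c ` S \<subseteq> C" using S c_pos by (force simp: K_def)
  ultimately show ?thesis using that by blast
qed

text \<open>The two extremal problems control a determinant from both sides. If \<open>U\<close> and
  its inverse have norms \<alpha> and \<beta>, the Loewner property bounds the determinant of U T by
  (\<alpha> / c)^D and the John property bounds that of its inverse by \<beta>^D. Their product is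
  1, so c <= \<alpha> \<beta>; the value c is attained at \<open>inv T\<close>.\<close>

lemma banach_mazur_distance_eq:
  "banach_mazur_distance smul N ((*s) :: 'k \<Rightarrow> 'k ^ 'n \<Rightarrow> 'k ^ 'n) norm = c"
proof -
  define D where "D = DIM('k ^ 'n)"
  have D: "D > 0" by (simp add: D_def)
  define p where "p U = operator_norm N norm U * operator_norm norm N (inv U)"
    for U :: "'a \<Rightarrow> 'k ^ 'n"
  have le: "c \<le> p U" if U: "Vector_Spaces.linear smul (*s) U" "bij U" for U :: "'a \<Rightarrow> 'k ^ 'n"
  proof -
    define \<alpha> where "\<alpha> = operator_norm N norm U"
    define \<beta> where "\<beta> = operator_norm norm N (inv U)"
    define F where "F = inv T \<circ> inv U"
    define G where "G = U \<circ> T"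
    have U_inv: "U (inv U y) = y" "inv U (U x) = x" for x y
      using U(2) by (simp_all add: bij_is_surj surj_f_inv_f bij_is_inj)
    have lin_invU: "Vector_Spaces.linear (*s) smul (inv U)"
      using U by (rule vector_space_linear_inv)
    have F: "Vector_Spaces.linear (*s) (*s) F" and G: "Vector_Spaces.linear (*s) (*s) G"
      unfolding F_def G_def
      using Vector_Spaces.linear_compose[OF lin_invU linear_inv_T]
        Vector_Spaces.linear_compose[OF linear_T U(1)] by auto
    note lF = linear_vec_imp_real_linear[OF F] and lG = linear_vec_imp_real_linear[OF G]
    have GF: "G (F y) = y" "F (G y) = y" for y
      by (simp_all add: F_def G_def U_inv)
    obtain BG where BG: "BG > 0" "\<And>x. norm (G x) \<le> BG * norm x"
      using linear_bounded_pos[OF lG] by metis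
    obtain BF where BF: "BF > 0" "\<And>x. norm (F x) \<le> BF * norm x"
      using linear_bounded_pos[OF lF] by metis
    have \<alpha>_ub: "norm (U x) \<le> \<alpha>" if "N x \<le> 1" for x
      unfolding \<alpha>_def operator_norm_def
    proof (rule cSup_upper)
      show "bdd_above {norm (U x) |x. x \<in> unit_ball N}"
      proof (rule bdd_aboveI[of _ "BG * c"], clarify)
        fix x assume "x \<in> unit_ball N"
        have "norm (U x) \<le> BG * norm (inv T x)" using BG(2)[of "inv T x"] by (simp add: G_def)
        also have "\<dots> \<le> BG * (c * N x)" using norm_le[of "inv T x"] BG(1) by simp
        also have "\<dots> \<le> BG * (c * 1)"
          using \<open>x \<in> unit_ball N\<close> BG(1) c_pos by (simp add: unit_ball_def)
        finally show "norm (U x) \<le> BG * c" by simp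
      qed
    qed (use that in \<open>auto simp: unit_ball_def\<close>)
    have \<beta>_ub: "N (inv U y) \<le> \<beta>" if "norm y \<le> 1" for y
      unfolding \<beta>_def operator_norm_def
    proof (rule cSup_upper)
      show "bdd_above {N (inv U x) |x. x \<in> unit_ball norm}"
      proof (rule bdd_aboveI[of _ "BF"], clarify)
        fix y :: "'k ^ 'n" assume "y \<in> unit_ball norm"
        have "N (inv U y) \<le> norm (F y)" using N_T_le[of "F y"] by (simp add: F_def)
        also have "\<dots> \<le> BF * norm y" by (rule BF(2))
        also have "\<dots> \<le> BF * 1"
          using \<open>y \<in> unit_ball norm\<close> BF(1) by (simp add: unit_ball_def)
        finally show "N (inv U y) \<le> BF" by simp
      qed
    qed (use that in \<open>auto simp: unit_ball_def\<close>)
    define e :: "'k ^ 'n" where "e = axis undefined 1"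
    have e: "norm e = 1" unfolding norm_eq_1 e_def inner_axis_axis by (simp add: dot_square_norm)
    have "\<beta> > 0"
    proof -
      have "inv U e \<noteq> 0"
        using e U_inv(1)[of e] vector_space_linearD(4)[OF U(1)] by auto
      then have "0 < N (inv U e)"
        using norm_nonneg[of "inv U e"] norm_eq_zero_iff[of "inv U e"] by simp
      then show ?thesis using \<beta>_ub[of e] e by simp
    qed
    have "\<alpha> > 0"
    proof -
      have "U (T e) \<noteq> 0"
        using e GF(2)[of e] linear_0[OF lF] by (auto simp: G_def)
      then show ?thesis using \<alpha>_ub[of "T e"] N_T_le[of e] e
        by (metis less_le_trans zero_less_norm_iff)
    qed
    define w where "w = measure lebesgue (F ` cball 0 1)"
    define v where "v = measure lebesgue (cball (0 :: 'k ^ 'n) 1)"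
    have v: "v > 0" unfolding v_def by (rule ball_measure_pos)
    have "\<bar>eucl_det (\<lambda>x. (c / \<alpha>) *\<^sub>R G x)\<bar> \<le> 1"
    proof (rule loewner_det_le)
      show "Vector_Spaces.linear (*s) (*s) (\<lambda>x. (c / \<alpha>) *\<^sub>R G x)"
        using G unfolding Vector_Spaces.linear_iff of_real_smult[symmetric]
        by (simp add: vec.scale_right_distrib vec.scale_left_commute)
      fix x assume "x \<in> C"
      then have "norm (G x) \<le> \<alpha>" using \<alpha>_ub[of "T x"] by (simp add: G_def C_def)
      then show "norm ((c / \<alpha>) *\<^sub>R G x) \<le> c"
        using c_pos \<open>\<alpha> > 0\<close> by (simp add: field_simps)
    qed
    then have det_G: "c ^ D * \<bar>eucl_det G\<bar> \<le> \<alpha> ^ D"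
      using c_pos \<open>\<alpha> > 0\<close>
      by (simp add: eucl_det_scaleR abs_mult power_divide field_simps D_def)
    have w_le: "w \<le> \<beta> ^ D * v"
    proof -
      define R where "R x = (1 / \<beta>) *\<^sub>R F x" for x
      have R: "Vector_Spaces.linear (*s) (*s) R"
        using F unfolding R_def Vector_Spaces.linear_iff of_real_smult[symmetric]
        by (simp add: vec.scale_right_distrib vec.scale_left_commute)
      have "T ` R ` cball 0 1 \<subseteq> unit_ball N"
      proof clarify
        fix y :: "'k ^ 'n" assume "y \<in> cball 0 1"
        then have "N (inv U y) \<le> \<beta>" by (intro \<beta>_ub) simp
        moreover have "T (R y) = smul (of_real (1 / \<beta>)) (inv U y)"
          by (simp add: R_def T_simps F_def flip: of_real_smult)
        ultimately show "T (R y) \<in> unit_ball N"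
          using \<open>\<beta> > 0\<close> by (simp add: unit_ball_def norm_scale norm_divide field_simps)
      qed
      then have "measure lebesgue (R ` cball 0 1) \<le> v"
        unfolding v_def using john ellipsoid_T_comp[OF R] by metis
      moreover have "R ` cball 0 1 = (*\<^sub>R) (1 / \<beta>) ` F ` cball 0 1"
        by (simp add: R_def image_image)
      ultimately show ?thesis
        using \<open>\<beta> > 0\<close>
        by (simp add: measure_lebesgue_scaleR w_def power_divide field_simps D_def)
    qed
    have "compact (F ` cball 0 1)"
      using lF by (intro compact_continuous_image compact_cball linear_continuous_on)
        (simp add: linear_conv_bounded_linear)
    from measure_linear_image_compact[OF lG this]
    have "v = \<bar>eucl_det G\<bar> * w" by (simp add: w_def v_def image_image GF)
    then have "c ^ D * v = (c ^ D * \<bar>eucl_det G\<bar>) * w" by simp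
    also have "\<dots> \<le> \<alpha> ^ D * (\<beta> ^ D * v)"
      using det_G w_le \<open>\<alpha> > 0\<close> by (intro mult_mono) (auto simp: w_def)
    finally have "c ^ D \<le> (\<alpha> * \<beta>) ^ D" using v by (simp add: power_mult_distrib)
    then have "c \<le> \<alpha> * \<beta>"
      using D c_pos \<open>\<alpha> > 0\<close> \<open>\<beta> > 0\<close> by (simp add: power_mono_iff)
    then show ?thesis by (simp add: p_def \<alpha>_def \<beta>_def)
  qed
  have "p (inv T) \<le> c"
  proof -
    have ne: "0 \<in> unit_ball N" using norm_eq_zero_iff[of 0] by (simp add: unit_ball_def)
    have "operator_norm N norm (inv T) \<le> c"
      unfolding operator_norm_def
    proof (rule cSup_least)
      fix y assume "y \<in> {norm (inv T x) |x. x \<in> unit_ball N}"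
      then obtain x where x: "N x \<le> 1" "y = norm (inv T x)" by (auto simp: unit_ball_def)
      have "y \<le> c * N x" using norm_le[of "inv T x"] x by simp
      also have "\<dots> \<le> c * 1" using x c_pos by (intro mult_left_mono) auto
      finally show "y \<le> c" by simp
    qed (use ne in blast)
    moreover have T: "inv (inv T) = T" using bij_T by (rule inv_inv_eq)
    have bdd: "bdd_above {N (T y) |y. y \<in> unit_ball (norm :: 'k ^ 'n \<Rightarrow> real)}"
      and le1: "\<And>r. r \<in> {N (T y) |y. y \<in> unit_ball (norm :: 'k ^ 'n \<Rightarrow> real)} \<Longrightarrow> r \<le> 1"
      using N_T_le by (auto simp: unit_ball_def intro!: bdd_aboveI[of _ 1] intro: order_trans)
    have T0: "0 \<in> {N (T y) |y. y \<in> unit_ball (norm :: 'k ^ 'n \<Rightarrow> real)}"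
      using norm_eq_zero_iff[of 0] T_simps(4) by (auto simp: unit_ball_def intro!: exI[of _ 0])
    have "operator_norm norm N T \<le> 1" "0 \<le> operator_norm norm N T"
      unfolding operator_norm_def using le1 T0 cSup_upper[OF T0 bdd] by (auto intro!: cSup_least)
    ultimately show ?thesis
      using mult_mono[of "operator_norm N norm (inv T)" c "operator_norm norm N T" 1] c_pos
      by (simp add: p_def T)
  qed
  moreover have "bij (inv T)" using bij_T by (rule bij_imp_bij_inv)
  ultimately have "c = p (inv T)" using le[OF linear_inv_T] by simp
  then have "c \<in> {p U |U. Vector_Spaces.linear smul (*s) U \<and> bij U}"
    using linear_inv_T \<open>bij (inv T)\<close> by blast
  then have "Inf {p U |U. Vector_Spaces.linear smul (*s) U \<and> bij U} = c"
    by (rule cInf_eq_minimum) (use le in blast)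
  then show ?thesis by (simp add: banach_mazur_distance_def p_def)
qed

end

subsection \<open>Tensors and multilinear forms\<close>

abbreviation lists_of :: "'j set \<Rightarrow> nat \<Rightarrow> 'j list set" where
  "lists_of J k \<equiv> {js. set js \<subseteq> J \<and> length js = k}"

lemma sum_lists_Suc:
  fixes f :: "'j list \<Rightarrow> 'b::comm_monoid_add"
  shows "(\<Sum>js\<in>lists_of J (Suc k). f js) = (\<Sum>j\<in>J. \<Sum>js\<in>lists_of J k. f (j # js))"
proof -
  have "lists_of J (Suc k) = (\<lambda>(j, js). j # js) ` (J \<times> lists_of J k)"
    by (auto simp: length_Suc_conv image_iff)
  moreover have "inj_on (\<lambda>(j, js). j # js) (J \<times> lists_of J k)"
    by (auto simp: inj_on_def)
  ultimately have "sum f (lists_of J (Suc k)) = (\<Sum>(j, js)\<in>J \<times> lists_of J k. f (j # js))"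
    by (simp add: sum.reindex case_prod_unfold)
  then show ?thesis by (simp add: sum.cartesian_product)
qed

text \<open>Distributivity for sums over multi-indices. It reduces the k-fold identities for
  weights, kernels and coefficient arrays to a single slot.\<close>

lemma prod_sum_lists:
  fixes f :: "nat \<Rightarrow> 'j \<Rightarrow> 'b::comm_semiring_1"
  shows "(\<Sum>js\<in>lists_of J k. \<Prod>l<k. f l (js ! l)) = (\<Prod>l<k. \<Sum>j\<in>J. f l j)"
proof (induction k arbitrary: f)
  case 0
  have "lists_of J 0 = {[]}" by auto
  then show ?case by simp
next
  case (Suc k)
  show ?case
    unfolding sum_lists_Suc
    by (simp add: prod.lessThan_Suc_shift Suc[of "\<lambda>l. f (Suc l)"] sum_distrib_right
        del: prod.lessThan_Suc flip: sum_distrib_left)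
qed

lemma multilinear_formD:
  "multilinear_form smul k A \<Longrightarrow> length xs = k \<Longrightarrow> i < k \<Longrightarrow>
    Vector_Spaces.linear smul (*) (\<lambda>v. A (xs[i := v]))"
  by (simp add: multilinear_form_def)

lemma multilinear_form_Cons:
  assumes "multilinear_form smul (Suc k) A"
  shows "multilinear_form smul k (\<lambda>xs. A (x # xs))"
  unfolding multilinear_form_def
proof safe
  fix xs :: "'b list" and i assume "i < length xs" "k = length xs"
  then show "Vector_Spaces.linear smul (*) (\<lambda>v. A (x # xs[i := v]))"
    using multilinear_formD[OF assms, of "x # xs" "Suc i"] by simp
qed

lemma multilinear_form_head:
  assumes "multilinear_form smul (Suc k) A" "length xs = k"
  shows "Vector_Spaces.linear smul (*) (\<lambda>v. A (v # xs))"
  using multilinear_formD[OF assms(1), of "undefined # xs" 0] assms(2) by simp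

lemma multilinear_form_prod:
  fixes l :: "nat \<Rightarrow> 'a::ab_group_add \<Rightarrow> 'k::real_normed_field"
  assumes l: "\<And>j. j < k \<Longrightarrow> Vector_Spaces.linear smul (*) (l j)"
  shows "multilinear_form smul k (\<lambda>xs. \<Prod>j<k. l j (xs ! j))"
  unfolding multilinear_form_def
proof safe
  fix xs :: "'a list" and i assume i: "i < length xs" "k = length xs"
  have eq: "(\<Prod>j<k. l j (xs[i := v] ! j)) = l i v * (\<Prod>j\<in>{..<k} - {i}. l j (xs ! j))" for v
    using i by (subst prod.remove[of _ i]) (auto simp: nth_list_update intro!: prod.cong)
  show "Vector_Spaces.linear smul (*) (\<lambda>v. \<Prod>j<length xs. l j (xs[i := v] ! j))"
    using l[of i] i unfolding i(2)[symmetric] eq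
    by (auto simp: Vector_Spaces.linear_iff distrib_right mult.assoc)
qed

text \<open>\<open>Vector_Spaces.linear\<close> also asserts that \<open>smul\<close> is a vector
  space structure; a member of the nonempty set \<open>I\<close> supplies this.\<close>

lemma multilinear_form_sum:
  fixes A :: "'i \<Rightarrow> 'a::ab_group_add list \<Rightarrow> 'k::real_normed_field"
  assumes "finite I" "I \<noteq> {}"
    and A: "\<And>a. a \<in> I \<Longrightarrow> multilinear_form smul k (A a)"
  shows "multilinear_form smul k (\<lambda>xs. \<Sum>a\<in>I. c a * A a xs)"
  unfolding multilinear_form_def
proof safe
  fix xs :: "'a list" and i assume i: "i < length xs" "k = length xs"
  obtain a where "a \<in> I" using assms(2) by blast
  have lin: "Vector_Spaces.linear smul (*) (\<lambda>v. A a (xs[i := v]))" if "a \<in> I" for a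
    using multilinear_formD[OF A[OF that]] i by blast
  show "Vector_Spaces.linear smul (*) (\<lambda>v. \<Sum>a\<in>I. c a * A a (xs[i := v]))"
    using lin lin[OF \<open>a \<in> I\<close>]
    by (simp add: Vector_Spaces.linear_iff distrib_left sum.distrib sum_distrib_left
        mult.left_commute)
qed

text \<open>The family \<open>w\<close> may be linearly dependent, as a frame usually is: only the
  reproducing formula is applied, in one slot after the other.\<close>

lemma multilinear_form_expand:
  assumes "multilinear_form smul k A" "length xs = k"
    and w: "\<And>x. x = (\<Sum>j\<in>J. smul (\<beta> j x) (w j))"
  shows "A xs = (\<Sum>js\<in>lists_of J k. (\<Prod>l<k. \<beta> (js ! l) (xs ! l)) * A (map w js))"
  using assms(1,2)
proof (induction k arbitrary: A xs)
  case 0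
  have "lists_of J 0 = {[]}" by auto
  then show ?case using 0 by simp
next
  case (Suc k)
  then obtain x ys where xs: "xs = x # ys" "length ys = k" by (auto simp: length_Suc_conv)
  note lin = vector_space_linearD[OF multilinear_form_head[OF Suc.prems(1) xs(2)]]
  have "A xs = (\<Sum>j\<in>J. \<beta> j x * A (w j # ys))"
    unfolding xs(1) by (subst w[of x]) (simp add: lin)
  also have "\<dots> = (\<Sum>j\<in>J. \<beta> j x * (\<Sum>js\<in>lists_of J k.
      (\<Prod>l<k. \<beta> (js ! l) (ys ! l)) * A (w j # map w js)))"
    using Suc.IH[OF multilinear_form_Cons[OF Suc.prems(1)] xs(2)] by simp
  also have "\<dots> = (\<Sum>js\<in>lists_of J (Suc k). (\<Prod>l<Suc k. \<beta> (js ! l) (xs ! l)) * A (map w js))"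
    by (simp add: sum_lists_Suc prod.lessThan_Suc_shift xs sum_distrib_left mult.assoc
        del: prod.lessThan_Suc)
  finally show ?case .
qed

section \<open>Frame expansions of tensors and representations for the projective norm\<close>

lemma tensor_powerE:
  assumes "z \<in> tensor_power smul k"
  obtains m :: nat and c x where
    "\<And>i. i < m \<Longrightarrow> length (x i) = k"
    "\<And>A. multilinear_form smul k A \<Longrightarrow> z A = (\<Sum>i<m. c i * A (x i))"
    "\<And>A. \<not> multilinear_form smul k A \<Longrightarrow> z A = 0"
proof -
  obtain m :: nat and c x where *: "\<forall>i<m. length (x i) = k"
    "z = (\<lambda>A. \<Sum>i<m. c i * elementary_tensor smul (x i) A)"
    using assms unfolding tensor_power_def by blast
  show ?thesis
    by (rule that[of m x c]) (use * in \<open>auto simp: elementary_tensor_def intro!: sum.cong sum.neutral\<close>)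
qed

text \<open>The coefficients are values of product functionals on \<open>z\<close>. These are the
  quantities that the injective norm controls when the functionals lie in the dual ball.\<close>

lemma tensor_power_expand:
  assumes z: "z \<in> tensor_power smul k"
    and w: "\<And>x. x = (\<Sum>j\<in>J. smul (\<beta> j x) (w j))"
    and \<beta>: "\<And>j. j \<in> J \<Longrightarrow> Vector_Spaces.linear smul (*) (\<beta> j)"
  shows "z = (\<lambda>A. \<Sum>js\<in>lists_of J k. tensor_functional k (\<lambda>l. \<beta> (js ! l)) z *
    elementary_tensor smul (map w js) A)"
proof
  fix A
  obtain m :: nat and c x where x: "\<And>i. i < m \<Longrightarrow> length (x i) = k"
    and zm: "\<And>A. multilinear_form smul k A \<Longrightarrow> z A = (\<Sum>i<m. c i * A (x i))"
    and z0: "\<And>A. \<not> multilinear_form smul k A \<Longrightarrow> z A = 0"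
    using tensor_powerE[OF z] by metis
  show "z A = (\<Sum>js\<in>lists_of J k. tensor_functional k (\<lambda>l. \<beta> (js ! l)) z *
    elementary_tensor smul (map w js) A)"
  proof (cases "multilinear_form smul k A")
    case True
    have *: "tensor_functional k (\<lambda>l. \<beta> (js ! l)) z = (\<Sum>i<m. c i * (\<Prod>l<k. \<beta> (js ! l) (x i ! l)))"
      if "js \<in> lists_of J k" for js
      unfolding tensor_functional_def
      by (rule zm, rule multilinear_form_prod, rule \<beta>) (use that in \<open>auto dest: nth_mem\<close>)
    have "z A = (\<Sum>i<m. c i * (\<Sum>js\<in>lists_of J k.
        (\<Prod>l<k. \<beta> (js ! l) (x i ! l)) * A (map w js)))"
      unfolding zm[OF True]
      by (rule sum.cong[OF refl]) (subst multilinear_form_expand[OF True x w], auto)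
    also have "\<dots> = (\<Sum>js\<in>lists_of J k. (\<Sum>i<m. c i * (\<Prod>l<k. \<beta> (js ! l) (x i ! l))) * A (map w js))"
      by (simp add: sum_distrib_left sum_distrib_right mult.assoc) (rule sum.swap)
    also have "\<dots> = (\<Sum>js\<in>lists_of J k. tensor_functional k (\<lambda>l. \<beta> (js ! l)) z *
        elementary_tensor smul (map w js) A)"
      by (rule sum.cong) (auto simp: * elementary_tensor_def True)
    finally show ?thesis .
  next
    case False
    then show ?thesis by (simp add: z0 elementary_tensor_def)
  qed
qed

definition projective_sums ::
    "('k::real_normed_field \<Rightarrow> 'a::ab_group_add \<Rightarrow> 'a) \<Rightarrow> ('a \<Rightarrow> real) \<Rightarrow> nat
      \<Rightarrow> (('a list \<Rightarrow> 'k) \<Rightarrow> 'k) \<Rightarrow> real set" where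
  "projective_sums smul N k z =
     {\<Sum>i<m. \<Prod>j<k. N (x i ! j) | (m::nat) x.
        (\<forall>i<m. length (x i) = k) \<and> z = (\<lambda>A. \<Sum>i<m. elementary_tensor smul (x i) A)}"

lemma projective_norm_eq_Inf: "projective_norm smul N k z = Inf (projective_sums smul N k z)"
  by (simp add: projective_norm_def projective_sums_def)

text \<open>The representations behind \<open>projective_sums\<close> carry no coefficients, so each
  \<open>c q\<close> is absorbed into the first vector of its list. This is where
  \<open>0 < k\<close> enters.\<close>

lemma (in normed_space) projective_sums_mem:
  assumes Q: "finite Q" and x: "\<And>q. q \<in> Q \<Longrightarrow> length (x q) = k" and k: "0 < k"
    and z: "z = (\<lambda>A. \<Sum>q\<in>Q. c q * elementary_tensor smul (x q) A)"
  shows "(\<Sum>q\<in>Q. norm (c q) * (\<Prod>j<k. N (x q ! j))) \<in> projective_sums smul N k z"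
proof -
  obtain h where h: "bij_betw h {..<card Q} Q"
    using ex_bij_betw_nat_finite[OF Q] by (auto simp: atLeast0LessThan)
  then have hQ: "h i \<in> Q" if "i < card Q" for i using that bij_betwE by blast
  define y where "y i = (x (h i))[0 := smul (c (h i)) (x (h i) ! 0)]" for i
  have y_len: "length (y i) = k" if "i < card Q" for i
    using x[OF hQ[OF that]] by (simp add: y_def)
  have y_el: "elementary_tensor smul (y i) A = c (h i) * elementary_tensor smul (x (h i)) A"
    if "i < card Q" for i A
  proof (cases "multilinear_form smul k A")
    case True
    have "A (y i) = c (h i) * A (x (h i))"
      using vector_space_linearD(2)[OF multilinear_formD[OF True x[OF hQ[OF that]] k]]
      by (simp add: y_def)
    then show ?thesis
      using y_len[OF that] x[OF hQ[OF that]] by (simp add: elementary_tensor_def)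
  next
    case False
    then show ?thesis using y_len[OF that] x[OF hQ[OF that]] by (simp add: elementary_tensor_def)
  qed
  have y_norm: "(\<Prod>j<k. N (y i ! j)) = norm (c (h i)) * (\<Prod>j<k. N (x (h i) ! j))"
    if "i < card Q" for i
  proof -
    obtain k' where k': "k = Suc k'" using k by (cases k) auto
    show ?thesis
      unfolding k' prod.lessThan_Suc_shift
      using x[OF hQ[OF that]] k' by (simp add: y_def norm_scale mult.assoc)
  qed
  have "z = (\<lambda>A. \<Sum>i<card Q. elementary_tensor smul (y i) A)"
    unfolding z by (rule ext) (simp add: y_el sum.reindex_bij_betw[OF h, symmetric])
  moreover have "(\<Sum>q\<in>Q. norm (c q) * (\<Prod>j<k. N (x q ! j))) = (\<Sum>i<card Q. \<Prod>j<k. N (y i ! j))"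
    by (simp add: y_norm sum.reindex_bij_betw[OF h, symmetric])
  ultimately show ?thesis
    unfolding projective_sums_def using y_len by blast
qed

lemma (in normed_space) projective_norm_le:
  assumes "r \<in> projective_sums smul N k z"
  shows "projective_norm smul N k z \<le> r"
  unfolding projective_norm_eq_Inf using assms
  by (rule cInf_lower)
    (auto simp: projective_sums_def intro!: bdd_belowI[of _ 0] sum_nonneg prod_nonneg norm_nonneg)

text \<open>Writing a squared modulus as a product with its conjugate lets the sum over
  multi-indices factor slot by slot. The result depends on the family \<open>f\<close> only through
  its one-slot kernel, so families with proportional kernels have proportional sums.\<close>

lemma (in conjugation) weighted_sum_squares:
  fixes smul :: "'k \<Rightarrow> 'a::ab_group_add \<Rightarrow> 'a"
  assumes z: "\<And>A. multilinear_form smul k A \<Longrightarrow> z A = (\<Sum>i<m. c i * A (x i))"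
    and f: "\<And>j. j \<in> J \<Longrightarrow> Vector_Spaces.linear smul (*) (f j)"
  shows "of_real (\<Sum>js\<in>lists_of J k. (\<Prod>l<k. b (js ! l)) *
      (norm (tensor_functional k (\<lambda>l. f (js ! l)) z))\<^sup>2) =
    (\<Sum>p<m. \<Sum>q<m. c p * cj (c q) *
      (\<Prod>l<k. \<Sum>j\<in>J. of_real (b j) * f j (x p ! l) * cj (f j (x q ! l))))"
proof -
  have zf: "tensor_functional k (\<lambda>l. f (js ! l)) z = (\<Sum>i<m. c i * (\<Prod>l<k. f (js ! l) (x i ! l)))"
    if "js \<in> lists_of J k" for js
    unfolding tensor_functional_def
    by (rule z, rule multilinear_form_prod, rule f) (use that in \<open>auto dest: nth_mem\<close>)
  have "of_real (\<Sum>js\<in>lists_of J k. (\<Prod>l<k. b (js ! l)) *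
      (norm (tensor_functional k (\<lambda>l. f (js ! l)) z))\<^sup>2) =
    (\<Sum>js\<in>lists_of J k. \<Sum>p<m. \<Sum>q<m. c p * cj (c q) *
      (\<Prod>l<k. of_real (b (js ! l)) * f (js ! l) (x p ! l) * cj (f (js ! l) (x q ! l))))"
    unfolding of_real_sum of_real_mult of_real_prod mult_cj[symmetric]
    by (rule sum.cong[OF refl])
      (simp add: zf cj_sum cj_mult cj_prod sum_product sum_distrib_left prod.distrib mult_ac,
        rule sum.swap)
  also have "\<dots> = (\<Sum>p<m. \<Sum>q<m. \<Sum>js\<in>lists_of J k. c p * cj (c q) *
      (\<Prod>l<k. of_real (b (js ! l)) * f (js ! l) (x p ! l) * cj (f (js ! l) (x q ! l))))"
    by (simp add: sum.swap[of _ _ "lists_of J k"])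
  finally show ?thesis unfolding prod_sum_lists[symmetric] sum_distrib_left .
qed

subsection \<open>The upper bound\<close>

context normed_space
begin

lemma dual_unit_ball_le:
  assumes l: "l \<in> dual_unit_ball smul N"
  shows "norm (l x) \<le> N x"
proof (cases "x = 0")
  case False
  then have pos: "0 < N x" using norm_nonneg[of x] norm_eq_zero_iff[of x] by simp
  have lin: "Vector_Spaces.linear smul (*) l" using l by (simp add: dual_unit_ball_def)
  have "smul (of_real (1 / N x)) x \<in> unit_ball N"
    using pos by (simp add: unit_ball_def norm_scale norm_divide)
  then have "norm (l (smul (of_real (1 / N x)) x)) \<le> 1"
    using l by (simp add: dual_unit_ball_def)
  then show ?thesis
    using pos by (simp add: vector_space_linearD[OF lin] norm_mult norm_divide field_simps)
next
  case True
  have "Vector_Spaces.linear smul (*) l" using l by (simp add: dual_unit_ball_def)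
  then show ?thesis using True norm_nonneg[of 0] by (simp add: vector_space_linearD)
qed

lemma zero_in_dual_unit_ball: "(\<lambda>_. 0) \<in> dual_unit_ball smul N"
  by (simp add: dual_unit_ball_def Vector_Spaces.linear_iff vector_space_axioms
      vector_space_over_itself.vector_space_axioms)

text \<open>The supremum in \<open>injective_norm\<close> says something only when its set is
  bounded; any finite representation of \<open>z\<close> provides a bound.\<close>

lemma norm_tensor_functional_le:
  assumes z: "z \<in> tensor_power smul k" and l: "\<And>j. j < k \<Longrightarrow> l j \<in> dual_unit_ball smul N"
  shows "norm (tensor_functional k l z) \<le> injective_norm smul N k z"
proof -
  obtain m :: nat and c x where x: "\<And>i. i < m \<Longrightarrow> length (x i) = k"
    and zm: "\<And>A. multilinear_form smul k A \<Longrightarrow> z A = (\<Sum>i<m. c i * A (x i))"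
    using tensor_powerE[OF z] by metis
  have "norm (tensor_functional k l z) \<le> (\<Sum>i<m. norm (c i) * (\<Prod>j<k. N (x i ! j)))"
    if l: "\<forall>j<k. l j \<in> dual_unit_ball smul N" for l
  proof -
    have "tensor_functional k l z = (\<Sum>i<m. c i * (\<Prod>j<k. l j (x i ! j)))"
      unfolding tensor_functional_def
      by (rule zm, rule multilinear_form_prod) (use l in \<open>auto simp: dual_unit_ball_def\<close>)
    also have "norm \<dots> \<le> (\<Sum>i<m. norm (c i) * (\<Prod>j<k. N (x i ! j)))"
      by (rule sum_norm_le)
        (use l in \<open>auto simp: norm_mult prod_norm[symmetric]
          intro!: mult_left_mono prod_mono dual_unit_ball_le\<close>)
    finally show ?thesis .
  qed
  then have "bdd_above {norm (tensor_functional k l z) | l. \<forall>j<k. l j \<in> dual_unit_ball smul N}"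
    by (auto intro!: bdd_aboveI)
  then show ?thesis
    unfolding injective_norm_def by (rule cSup_upper[rotated]) (use l in auto)
qed

lemma injective_norm_le:
  assumes "\<And>l. (\<And>j. j < k \<Longrightarrow> l j \<in> dual_unit_ball smul N) \<Longrightarrow> norm (tensor_functional k l z) \<le> B"
  shows "injective_norm smul N k z \<le> B"
  unfolding injective_norm_def
proof (rule cSup_least)
  show "{norm (tensor_functional k l z) | l. \<forall>j<k. l j \<in> dual_unit_ball smul N} \<noteq> {}"
    using zero_in_dual_unit_ball by auto
qed (use assms in blast)

lemma injective_norm_nonneg: "z \<in> tensor_power smul k \<Longrightarrow> 0 \<le> injective_norm smul N k z"
  using norm_tensor_functional_le[of z k "\<lambda>_ _. 0"] zero_in_dual_unit_ball
  by (meson norm_ge_zero order_trans)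

end

lemma tensor_functional_scale:
  assumes z: "z \<in> tensor_power smul k"
    and f: "\<And>l. l < k \<Longrightarrow> Vector_Spaces.linear smul (*) (f l)"
  shows "tensor_functional k (\<lambda>l x. a l * f l x) z = (\<Prod>l<k. a l) * tensor_functional k f z"
proof -
  obtain m :: nat and c x where
    zm: "\<And>A. multilinear_form smul k A \<Longrightarrow> z A = (\<Sum>i<m. c i * A (x i))"
    using tensor_powerE[OF z] by metis
  have af: "Vector_Spaces.linear smul (*) (\<lambda>x. a l * f l x)" if "l < k" for l
    using f[OF that] by (simp add: Vector_Spaces.linear_iff distrib_left mult.left_commute)
  have "tensor_functional k (\<lambda>l x. a l * f l x) z = (\<Sum>i<m. c i * (\<Prod>l<k. a l * f l (x i ! l)))"
    unfolding tensor_functional_def by (rule zm, rule multilinear_form_prod, rule af)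
  moreover have "tensor_functional k f z = (\<Sum>i<m. c i * (\<Prod>l<k. f l (x i ! l)))"
    unfolding tensor_functional_def by (rule zm, rule multilinear_form_prod, rule f)
  ultimately show ?thesis by (simp add: prod.distrib sum_distrib_left mult.left_commute)
qed

text \<open>Pairing the frame identity with \<open>y\<close> shows that the kernel of a tight frame
  depends on the frame only through \<open>r\<close>.\<close>

lemma (in conjugation) tight_frame_kernel:
  assumes "tight_frame S b r"
  shows "(\<Sum>v\<in>S. of_real (b v) * herm x v * cj (herm y v)) =
    of_real (r / CARD('n)) * herm x (y :: 'k ^ 'n::finite)"
proof -
  have "(\<Sum>v\<in>S. of_real (b v) * herm x v * cj (herm y v)) =
      herm (\<Sum>v\<in>S. (of_real (b v) * herm x v) *s v) y"
    by (simp add: herm_sum_left herm_smult_left cj_herm)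
  also have "(\<Sum>v\<in>S. (of_real (b v) * herm x v) *s v) = of_real (r / CARD('n)) *s x"
    using assms by (simp add: tight_frame_def)
  finally show ?thesis by (simp only: herm_smult_left)
qed

context proportional_ellipsoids
begin

lemma linear_herm_inv_T: "Vector_Spaces.linear smul (*) (\<lambda>x. herm (inv T x) v)"
  by (simp add: Vector_Spaces.linear_iff vector_space_axioms inv_T_simps herm_add_left
      herm_smult_left vector_space_over_itself.vector_space_axioms)

lemma herm_in_dual_unit_ball:
  assumes "y \<in> polar_C"
  shows "(\<lambda>x. herm (inv T x) y) \<in> dual_unit_ball smul N"
proof -
  have "norm (herm (inv T x) y) \<le> 1" if "x \<in> unit_ball N" for x
  proof -
    obtain a where a: "norm a = 1" "norm (herm (inv T x) y) = (a *s inv T x) \<bullet> y"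
      by (rule norm_herm_eq_inner)
    have "a *s inv T x \<in> C" using that a(1) by (intro C_smult) (simp_all add: C_def unit_ball_def)
    then show ?thesis using assms a(2) by (simp add: polar_C_def)
  qed
  then show ?thesis using linear_herm_inv_T by (simp add: dual_unit_ball_def)
qed

text \<open>Both kernels are multiples of the same form \<open>herm\<close>, with ratio
  \<open>r\<close> in each of the \<open>k\<close> slots. It is here that having one inner product
  for both ellipsoids is used.\<close>

lemma weighted_squares_tight_frame:
  assumes z: "z \<in> tensor_power smul k" and fr: "tight_frame S b r" "tight_frame S' b' 1"
  shows "(\<Sum>js\<in>lists_of S k. (\<Prod>l<k. b (js ! l)) *
      (norm (tensor_functional k (\<lambda>l x. herm (inv T x) (js ! l)) z))\<^sup>2) =
    r ^ k * (\<Sum>js\<in>lists_of S' k. (\<Prod>l<k. b' (js ! l)) *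
      (norm (tensor_functional k (\<lambda>l x. herm (inv T x) (js ! l)) z))\<^sup>2)" (is "?L = r ^ k * ?R")
proof -
  obtain m :: nat and c x where
    zm: "\<And>A. multilinear_form smul k A \<Longrightarrow> z A = (\<Sum>i<m. c i * A (x i))"
    using tensor_powerE[OF z] by metis
  define H where "H p q l = herm (inv T (x p ! l)) (inv T (x q ! l))" for p q l
  have L: "of_real ?L = (\<Sum>p<m. \<Sum>q<m. c p * cj (c q) * (\<Prod>l<k. of_real (r / CARD('n)) * H p q l))"
    unfolding H_def tight_frame_kernel[OF fr(1), symmetric]
    by (rule weighted_sum_squares[where f = "\<lambda>v x. herm (inv T x) v"])
      (rule zm, assumption, rule linear_herm_inv_T)
  have R: "of_real ?R = (\<Sum>p<m. \<Sum>q<m. c p * cj (c q) * (\<Prod>l<k. of_real (1 / CARD('n)) * H p q l))"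
    unfolding H_def tight_frame_kernel[OF fr(2), symmetric]
    by (rule weighted_sum_squares[where f = "\<lambda>v x. herm (inv T x) v"])
      (rule zm, assumption, rule linear_herm_inv_T)
  have "of_real ?L = of_real (r ^ k) * (of_real ?R :: 'k)"
  proof -
    have r: "of_real (r / CARD('n)) * h = of_real r * (of_real (1 / CARD('n)) * h)" for h :: 'k
      by simp
    have "(\<Prod>l<k. of_real (r / CARD('n)) * H p q l) =
        of_real (r ^ k) * (\<Prod>l<k. of_real (1 / CARD('n)) * H p q l)" for p q
      by (simp only: r prod.distrib prod_constant card_lessThan of_real_power)
    then show ?thesis
      unfolding L R by (simp only: sum_distrib_left mult.left_commute[of _ "of_real (r ^ k)"])
  qed
  then have "of_real ?L = (of_real (r ^ k * ?R) :: 'k)" by (simp only: of_real_mult)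
  then show ?thesis by (simp only: of_real_eq_iff)
qed

lemma sum_prod_weights:
  assumes "tight_frame S b r"
  shows "(\<Sum>js\<in>lists_of S k. \<Prod>l<k. b (js ! l)) = 1"
  using assms by (simp add: prod_sum_lists[of "\<lambda>_. b"] tight_frame_def)

lemma prod_weights_nonneg:
  assumes "tight_frame S b r" "js \<in> lists_of S k"
  shows "0 \<le> (\<Prod>l<k. b (js ! l))"
  using assms by (intro prod_nonneg) (auto simp: tight_frame_def dest!: nth_mem)

theorem projective_norm_le_injective_norm:
  assumes z: "z \<in> tensor_power smul k" and k: "0 < k"
  shows "projective_norm smul N k z \<le> (CARD('n) / c) ^ k * injective_norm smul N k z"
proof -
  define n where "n = real CARD('n)"
  have n: "n > 0" by (simp add: n_def)
  define \<epsilon> where "\<epsilon> = injective_norm smul N k z"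
  have \<epsilon>: "0 \<le> \<epsilon>" unfolding \<epsilon>_def by (rule injective_norm_nonneg[OF z])
  obtain S b where S: "S \<subseteq> C" and fr: "tight_frame S b (c\<^sup>2)" by (rule loewner_vectors)
  obtain S' b' where S': "S' \<subseteq> polar_C" and fr': "tight_frame S' b' 1" by (rule john_functionals)
  have fin: "finite (lists_of S k)"
    using fr by (intro finite_lists_length_eq) (simp add: tight_frame_def)
  define f where "f v x = herm (inv T x) v" for v x
  define t where "t js = norm (tensor_functional k (\<lambda>l. f (js ! l)) z)" for js
  define B where "B js = (\<Prod>l<k. b (js ! l))" for js
  have B_nonneg: "0 \<le> B js" if "js \<in> lists_of S k" for js
    unfolding B_def by (rule prod_weights_nonneg[OF fr that])
  \<comment> \<open>The frame identity reproduces vectors up to the factor c^2 / n; its inverse is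
    put into the coefficient functionals.\<close>
  define \<beta> where "\<beta> v x = of_real (n / c\<^sup>2 * b v) * f v x" for v x
  have f_lin: "Vector_Spaces.linear smul (*) (f v)" for v
    unfolding f_def by (rule linear_herm_inv_T)
  have \<beta>_lin: "Vector_Spaces.linear smul (*) (\<beta> v)" for v
  proof -
    have "Vector_Spaces.linear smul (*) (\<lambda>x. a * f v x)" for a
      using f_lin[of v] by (simp add: Vector_Spaces.linear_iff distrib_left mult.left_commute)
    then show ?thesis unfolding \<beta>_def[abs_def] .
  qed
  have expand: "x = (\<Sum>v\<in>S. smul (\<beta> v x) (T v))" for x
  proof -
    have "(\<Sum>v\<in>S. smul (\<beta> v x) (T v)) =
        T (\<Sum>v\<in>S. of_real (n / c\<^sup>2) *s ((of_real (b v) * herm (inv T x) v) *s v))"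
      by (simp add: T_simps \<beta>_def f_def mult.assoc)
    also have "\<dots> = T (of_real (n / c\<^sup>2) *s (of_real (c\<^sup>2 / n) *s inv T x))"
      using fr by (simp only: vec.scale_sum_right[symmetric] tight_frame_def n_def)
    also have "of_real (n / c\<^sup>2) *s (of_real (c\<^sup>2 / n) *s inv T x) = inv T x"
      using n c_pos by (simp add: of_real_smult)
    finally show ?thesis by simp
  qed
  have tf: "norm (tensor_functional k (\<lambda>l. \<beta> (js ! l)) z) = (n / c\<^sup>2) ^ k * (B js * t js)"
    if js: "js \<in> lists_of S k" for js
  proof -
    have "tensor_functional k (\<lambda>l. \<beta> (js ! l)) z =
        (\<Prod>l<k. of_real (n / c\<^sup>2 * b (js ! l))) * tensor_functional k (\<lambda>l. f (js ! l)) z"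
      unfolding \<beta>_def[abs_def] by (rule tensor_functional_scale[OF z f_lin])
    also have "(\<Prod>l<k. of_real (n / c\<^sup>2 * b (js ! l))) = (of_real ((n / c\<^sup>2) ^ k * B js) :: 'k)"
      by (simp only: of_real_prod[symmetric] B_def prod.distrib prod_constant card_lessThan)
    finally have eq: "tensor_functional k (\<lambda>l. \<beta> (js ! l)) z =
        of_real ((n / c\<^sup>2) ^ k * B js) * tensor_functional k (\<lambda>l. f (js ! l)) z" .
    have "0 \<le> (n / c\<^sup>2) ^ k * B js" using B_nonneg[OF js] n by simp
    then show ?thesis
      by (simp only: eq norm_mult norm_of_real t_def abs_of_nonneg mult.assoc)
  qed
  have "projective_norm smul N k z \<le>
      (\<Sum>js\<in>lists_of S k. norm (tensor_functional k (\<lambda>l. \<beta> (js ! l)) z) * (\<Prod>j<k. N (map T js ! j)))"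
    by (rule projective_norm_le,
        rule projective_sums_mem[OF fin _ k tensor_power_expand[OF z expand \<beta>_lin]]) auto
  also have "\<dots> \<le> (\<Sum>js\<in>lists_of S k. norm (tensor_functional k (\<lambda>l. \<beta> (js ! l)) z) * 1)"
    using S
    by (intro sum_mono mult_left_mono prod_le_1) (auto simp: C_def norm_nonneg dest!: nth_mem)
  also have "\<dots> = (n / c\<^sup>2) ^ k * (\<Sum>js\<in>lists_of S k. B js * t js)"
    by (simp add: tf sum_distrib_left)
  also have "\<dots> \<le> (n / c\<^sup>2) ^ k * (c ^ k * \<epsilon>)"
  proof (rule mult_left_mono)
    have "(\<Sum>js\<in>lists_of S' k. (\<Prod>l<k. b' (js ! l)) * (t js)\<^sup>2) \<le>
        (\<Sum>js\<in>lists_of S' k. (\<Prod>l<k. b' (js ! l)) * \<epsilon>\<^sup>2)"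
    proof (intro sum_mono mult_left_mono power_mono)
      fix js assume js: "js \<in> lists_of S' k"
      show "t js \<le> \<epsilon>"
        unfolding t_def \<epsilon>_def f_def[abs_def]
        using js S' by (intro norm_tensor_functional_le[OF z] herm_in_dual_unit_ball) (auto dest!: nth_mem)
      show "0 \<le> (\<Prod>l<k. b' (js ! l))" using fr' js by (rule prod_weights_nonneg)
    qed (simp add: t_def)
    also have "\<dots> = \<epsilon>\<^sup>2"
      by (simp add: sum_prod_weights[OF fr'] flip: sum_distrib_right)
    finally have squares: "(\<Sum>js\<in>lists_of S' k. (\<Prod>l<k. b' (js ! l)) * (t js)\<^sup>2) \<le> \<epsilon>\<^sup>2" .
    \<comment> \<open>The weights \<open>B js\<close> sum to 1, so Cauchy-Schwarz bounds the
      weighted mean of \<open>t\<close> by its quadratic mean, which the change of frame can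
      handle.\<close>
    have "(\<Sum>js\<in>lists_of S k. B js * t js)\<^sup>2 =
        (\<Sum>js\<in>lists_of S k. sqrt (B js) * (sqrt (B js) * t js))\<^sup>2"
      using B_nonneg by (intro arg_cong[of _ _ "\<lambda>x. x\<^sup>2"] sum.cong) (auto simp flip: mult.assoc)
    also have "\<dots> \<le> (\<Sum>js\<in>lists_of S k. (sqrt (B js))\<^sup>2) * (\<Sum>js\<in>lists_of S k. (sqrt (B js) * t js)\<^sup>2)"
      by (rule Cauchy_Schwarz_ineq_sum)
    also have "(\<Sum>js\<in>lists_of S k. (sqrt (B js))\<^sup>2) = (\<Sum>js\<in>lists_of S k. B js)"
      using B_nonneg by (intro sum.cong) auto
    also have "\<dots> = 1" unfolding B_def by (rule sum_prod_weights[OF fr])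
    also have "(\<Sum>js\<in>lists_of S k. (sqrt (B js) * t js)\<^sup>2) = (\<Sum>js\<in>lists_of S k. B js * (t js)\<^sup>2)"
      using B_nonneg by (intro sum.cong) (auto simp: power_mult_distrib)
    also have "\<dots> = (c\<^sup>2) ^ k * (\<Sum>js\<in>lists_of S' k. (\<Prod>l<k. b' (js ! l)) * (t js)\<^sup>2)"
      unfolding B_def t_def f_def[abs_def] by (rule weighted_squares_tight_frame[OF z fr fr'])
    also have "\<dots> \<le> (c\<^sup>2) ^ k * \<epsilon>\<^sup>2" by (intro mult_left_mono squares) simp
    finally have "(\<Sum>js\<in>lists_of S k. B js * t js)\<^sup>2 \<le> (c ^ k * \<epsilon>)\<^sup>2"
      by (simp add: power_mult_distrib mult.commute[of k] flip: power_mult)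
    then show "(\<Sum>js\<in>lists_of S k. B js * t js) \<le> c ^ k * \<epsilon>"
      by (rule power2_le_imp_le) (use \<epsilon> c_pos in simp)
  qed (use n in simp)
  also have "\<dots> = (n / c) ^ k * \<epsilon>"
    using c_pos by (simp add: power_divide power2_eq_square power_mult_distrib)
  finally show ?thesis by (simp add: n_def \<epsilon>_def)
qed

end

subsection \<open>Tensors with small injective norm\<close>

text \<open>The sub-Gaussian bound for one random sign, with constant 1 instead of 1/2; this version
  follows from elementary estimates of \<open>exp\<close> on the unit interval.\<close>

lemma cosh_le_exp_square:
  fixes x :: real
  assumes "\<bar>x\<bar> \<le> 1"
  shows "cosh x \<le> exp (x\<^sup>2)"
proof -
  have "cosh y \<le> exp (y\<^sup>2)" if y: "0 \<le> y" "y \<le> 1" for y :: real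
  proof -
    have "exp (- y) \<le> 1 / (1 + y)"
      using exp_ge_add_one_self[of y] y by (simp add: exp_minus field_simps)
    also have "\<dots> \<le> 1 - y + y\<^sup>2"
    proof -
      have "1 \<le> (1 - y + y\<^sup>2) * (1 + y)"
        using y by (simp add: algebra_simps power2_eq_square)
      then show ?thesis using y by (simp add: divide_le_eq)
    qed
    finally have "cosh y \<le> 1 + y\<^sup>2"
      using exp_bound[OF y] by (simp add: cosh_def)
    then show ?thesis using exp_ge_add_one_self[of "y\<^sup>2"] by linarith
  qed
  from this[of "\<bar>x\<bar>"] show ?thesis using assms by (simp add: cosh_real_abs)
qed

text \<open>Derandomisation: the potential does not increase on average over the two choices of a sign.\<close>

lemma exists_signs_potential:
  fixes r :: "'q \<Rightarrow> 'i \<Rightarrow> real"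
  assumes "finite I" and "\<And>q i. q \<in> Q \<Longrightarrow> i \<in> I \<Longrightarrow> \<bar>r q i\<bar> \<le> 1"
  shows "\<exists>\<sigma>. (\<forall>i. \<sigma> i = 1 \<or> \<sigma> i = -1) \<and>
    (\<Sum>q\<in>Q. cosh (\<Sum>i\<in>I. \<sigma> i * r q i) * exp (- (\<Sum>i\<in>I. (r q i)\<^sup>2))) \<le> card Q"
  using assms
proof (induction I rule: finite_induct)
  case empty
  then show ?case by (auto intro!: exI[of _ "\<lambda>_. 1"])
next
  case (insert i I)
  then obtain \<sigma> :: "'i \<Rightarrow> real" where \<sigma>: "\<And>i. \<sigma> i = 1 \<or> \<sigma> i = -1"
    "(\<Sum>q\<in>Q. cosh (\<Sum>i\<in>I. \<sigma> i * r q i) * exp (- (\<Sum>i\<in>I. (r q i)\<^sup>2))) \<le> card Q"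
    by auto
  define s where "s q = (\<Sum>i\<in>I. \<sigma> i * r q i)" for q
  define e where "e q = exp (- (\<Sum>i\<in>I. (r q i)\<^sup>2))" for q
  define \<Phi> where "\<Phi> a = (\<Sum>q\<in>Q. cosh (a * r q i + s q) * (e q * exp (- (r q i)\<^sup>2)))" for a
  \<comment> \<open>The odd terms in \<open>sinh\<close> cancel. What remains is the old potential
    with an extra factor per summand, which \<open>cosh_le_exp_square\<close> bounds by 1.\<close>
  have "\<Phi> 1 + \<Phi> (-1) = (\<Sum>q\<in>Q. 2 * (cosh (s q) * e q) * (cosh (r q i) * exp (- (r q i)\<^sup>2)))"
    unfolding \<Phi>_def sum.distrib[symmetric]
    by (rule sum.cong[OF refl]) (simp add: cosh_add cosh_diff algebra_simps)
  also have "\<dots> \<le> (\<Sum>q\<in>Q. 2 * (cosh (s q) * e q) * 1)"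
  proof (rule sum_mono, rule mult_left_mono)
    fix q assume "q \<in> Q"
    then show "cosh (r q i) * exp (- (r q i)\<^sup>2) \<le> 1"
      using cosh_le_exp_square[of "r q i"] insert.prems by (simp add: exp_minus field_simps)
  qed (simp add: e_def)
  also have "\<dots> \<le> 2 * card Q"
    using \<sigma>(2) by (simp add: s_def e_def flip: sum_distrib_left)
  finally have "\<Phi> 1 \<le> card Q \<or> \<Phi> (-1) \<le> card Q" by linarith
  then obtain a :: real where a: "a = 1 \<or> a = -1" "\<Phi> a \<le> card Q" by blast
  have e_insert: "exp (- (\<Sum>j\<in>insert i I. (r q j)\<^sup>2)) = e q * exp (- (r q i)\<^sup>2)" for q
    using insert.hyps by (simp add: e_def exp_diff exp_minus field_simps)
  have "(\<Sum>j\<in>I. (\<sigma>(i := a)) j * r q j) = s q" for q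
    unfolding s_def using insert.hyps by (intro sum.cong) auto
  then have "(\<Sum>q\<in>Q. cosh (\<Sum>j\<in>insert i I. (\<sigma>(i := a)) j * r q j) *
      exp (- (\<Sum>j\<in>insert i I. (r q j)\<^sup>2))) = \<Phi> a"
    using insert.hyps e_insert by (simp add: \<Phi>_def del: fun_upd_apply) simp
  then show ?case
    using a \<sigma>(1) by (intro exI[of _ "\<sigma>(i := a)"]) simp
qed

text \<open>Each summand is at most the whole potential, and \<open>cosh s\<close> is at least half
  of \<open>exp \<bar>s\<bar>\<close>; taking logarithms gives a bound that grows only
  logarithmically with the number of test points.\<close>

lemma exists_signs:
  fixes r :: "'q \<Rightarrow> 'i \<Rightarrow> real"
  assumes I: "finite I" and Q: "finite Q"
    and r: "\<And>q. q \<in> Q \<Longrightarrow> (\<Sum>i\<in>I. (r q i)\<^sup>2) \<le> 1"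
  obtains \<sigma> :: "'i \<Rightarrow> real" where "\<And>i. \<sigma> i = 1 \<or> \<sigma> i = -1"
    "\<And>q. q \<in> Q \<Longrightarrow> \<bar>\<Sum>i\<in>I. \<sigma> i * r q i\<bar> \<le> 1 + ln (2 * card Q)"
proof -
  have "\<bar>r q i\<bar> \<le> 1" if "q \<in> Q" "i \<in> I" for q i
  proof -
    have "(r q i)\<^sup>2 \<le> (\<Sum>i\<in>I. (r q i)\<^sup>2)" using I that by (intro member_le_sum) auto
    then have "(r q i)\<^sup>2 \<le> 1" using r[OF that(1)] by linarith
    then show ?thesis by (simp add: abs_square_le_1)
  qed
  from exists_signs_potential[OF I, of Q r, OF this] obtain \<sigma> :: "'i \<Rightarrow> real"
    where \<sigma>: "\<And>i. \<sigma> i = 1 \<or> \<sigma> i = -1"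
    "(\<Sum>q\<in>Q. cosh (\<Sum>i\<in>I. \<sigma> i * r q i) * exp (- (\<Sum>i\<in>I. (r q i)\<^sup>2))) \<le> card Q"
    by blast
  have "\<bar>\<Sum>i\<in>I. \<sigma> i * r q i\<bar> \<le> 1 + ln (2 * card Q)" if q: "q \<in> Q" for q
  proof -
    define s where "s = (\<Sum>i\<in>I. \<sigma> i * r q i)"
    have pos: "0 < card Q" using q Q card_gt_0_iff by blast
    have half: "exp \<bar>s\<bar> / 2 \<le> cosh s" by (simp add: cosh_def abs_if)
    have "cosh s * exp (-1) \<le> cosh s * exp (- (\<Sum>i\<in>I. (r q i)\<^sup>2))"
      using r[OF q] by (intro mult_left_mono) auto
    also have "\<dots> \<le> card Q"
      using member_le_sum[OF q, of "\<lambda>q. cosh (\<Sum>i\<in>I. \<sigma> i * r q i) * exp (- (\<Sum>i\<in>I. (r q i)\<^sup>2))"]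
        \<sigma>(2) Q by (simp add: s_def)
    finally have "cosh s \<le> exp 1 * card Q" by (simp add: exp_minus field_simps)
    with half have "exp \<bar>s\<bar> \<le> exp 1 * (2 * card Q)" by simp
    also have "\<dots> = exp (1 + ln (2 * card Q))" using pos by (simp add: exp_add)
    finally show ?thesis by (simp add: s_def)
  qed
  with \<sigma>(1) show ?thesis using that by blast
qed

text \<open>Replacing a unit vector by a nearby net point shows that the operator norm B satisfies B
  <= g + \<delta> B, which is solved for B.\<close>

lemma linear_form_net_bound:
  fixes L :: "'k::{real_normed_field, euclidean_space} ^ 'n::finite \<Rightarrow> 'k"
  assumes L: "Vector_Spaces.linear (*s) (*) L"
    and net: "\<And>y. norm y \<le> 1 \<Longrightarrow> \<exists>p\<in>P. norm (y - p) \<le> \<delta>"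
    and \<delta>: "\<delta> < 1" and g: "\<And>p. p \<in> P \<Longrightarrow> norm (L p) \<le> g"
  shows "norm (L y) \<le> g / (1 - \<delta>) * norm y"
proof -
  note lin = vector_space_linearD[OF L]
  have "linear L"
    by (rule linearI) (simp_all add: lin scaleR_conv_of_real[where 'a = 'k] flip: of_real_smult)
  then have bl: "bounded_linear L" by (simp add: linear_conv_bounded_linear)
  define B where "B = onorm L"
  have LB: "norm (L x) \<le> B * norm x" for x unfolding B_def by (rule onorm[OF bl])
  have "onorm L \<le> g + \<delta> * B"
  proof (rule onorm_le)
    fix x :: "'k ^ 'n"
    have "norm (sgn x) \<le> 1" by (simp add: norm_sgn)
    then obtain p where p: "p \<in> P" "norm (sgn x - p) \<le> \<delta>" using net by blast
    have "norm (L (sgn x)) \<le> norm (L p) + norm (L (sgn x - p))"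
      using norm_triangle_ineq[of "L p" "L (sgn x - p)"] by (simp add: lin)
    also have "\<dots> \<le> g + B * \<delta>"
    proof (rule add_mono)
      have "0 \<le> B" unfolding B_def by (rule onorm_pos_le[OF bl])
      then show "norm (L (sgn x - p)) \<le> B * \<delta>"
        using LB[of "sgn x - p"] mult_left_mono[OF p(2)] by fastforce
    qed (rule g[OF p(1)])
    finally have *: "norm (L (sgn x)) \<le> g + \<delta> * B" by (simp add: mult.commute)
    have "L x = of_real (norm x) * L (sgn x)"
      unfolding lin(2)[symmetric] of_real_smult by (cases "x = 0") (simp_all add: sgn_div_norm)
    then show "norm (L x) \<le> (g + \<delta> * B) * norm x"
      using mult_left_mono[OF *, of "norm x"] by (simp add: norm_mult mult.commute)
  qed
  then have "B \<le> g / (1 - \<delta>)" using \<delta> by (simp add: B_def field_simps)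
  then have "B * norm y \<le> g / (1 - \<delta>) * norm y" by (rule mult_right_mono) simp
  then show ?thesis using LB[of y] by simp
qed

text \<open>The linear bound is applied to one slot at a time, and each slot loses a factor 1 / (1 -
  \<delta>).\<close>

lemma multilinear_form_net_bound:
  fixes F :: "('k::{real_normed_field, euclidean_space} ^ 'n::finite) list \<Rightarrow> 'k"
  assumes net: "\<And>y :: 'k ^ 'n. norm y \<le> 1 \<Longrightarrow> \<exists>p\<in>P. norm (y - p) \<le> \<delta>" and \<delta>: "\<delta> < 1"
  shows "multilinear_form (*s) k F \<Longrightarrow> (\<And>ps. ps \<in> lists_of P k \<Longrightarrow> norm (F ps) \<le> g) \<Longrightarrow>
    length ys = k \<Longrightarrow> norm (F ys) \<le> g / (1 - \<delta>) ^ k * (\<Prod>l<k. norm (ys ! l))"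
proof (induction k arbitrary: F ys)
  case 0
  then show ?case by simp
next
  case (Suc k)
  then obtain x zs where ys: "ys = x # zs" "length zs = k" by (auto simp: length_Suc_conv)
  have "norm (F (p # zs)) \<le> g / (1 - \<delta>) ^ k * (\<Prod>l<k. norm (zs ! l))" if "p \<in> P" for p
    using that ys(2) by (intro Suc.IH multilinear_form_Cons[OF Suc.prems(1)] Suc.prems(2)) auto
  then have "norm (F (x # zs)) \<le> g / (1 - \<delta>) ^ k * (\<Prod>l<k. norm (zs ! l)) / (1 - \<delta>) * norm x"
    by (rule linear_form_net_bound[OF multilinear_form_head[OF Suc.prems(1) ys(2)] net \<delta>, rotated])
  also have "\<dots> = g / (1 - \<delta>) ^ Suc k * (\<Prod>l<Suc k. norm (ys ! l))"
    by (simp add: ys prod.lessThan_Suc_shift mult_ac del: prod.lessThan_Suc)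
  finally show ?case by (simp add: ys)
qed

lemma finite_net:
  assumes "0 < \<delta>"
  obtains P :: "'a::euclidean_space set" where "finite P" "P \<noteq> {}" "P \<subseteq> cball 0 1"
    "\<And>y. norm y \<le> 1 \<Longrightarrow> \<exists>p\<in>P. norm (y - p) \<le> \<delta>"
proof -
  obtain P where P: "finite P" "P \<subseteq> cball (0 :: 'a) 1" "cball 0 1 \<subseteq> (\<Union>p\<in>P. ball p \<delta>)"
    using compactE_image[OF compact_cball[of "0 :: 'a" 1], of "cball 0 1" "\<lambda>p. ball p \<delta>"] assms
    by (metis (no_types, lifting) UN_I centre_in_ball open_ball subsetI)
  have "\<exists>p\<in>P. norm (y - p) \<le> \<delta>" if y: "norm y \<le> 1" for y :: 'a
  proof -
    have "y \<in> (\<Union>p\<in>P. ball p \<delta>)" by (rule subsetD[OF P(3)]) (simp add: y)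
    then obtain p where "p \<in> P" "y \<in> ball p \<delta>" by blast
    then show ?thesis by (intro bexI[of _ p]) (auto simp: dist_norm norm_minus_commute)
  qed
  moreover from this[of 0] have "P \<noteq> {}" by auto
  ultimately show ?thesis using that P by blast
qed

section \<open>Sign forms of small norm\<close>

definition sign_form :: "nat \<Rightarrow> ('n list \<Rightarrow> real) \<Rightarrow> ('k::real_normed_field ^ 'n::finite) list \<Rightarrow> 'k" where
  "sign_form k \<sigma> ys = (\<Sum>is\<in>lists_of UNIV k. of_real (\<sigma> is) * (\<Prod>l<k. ys ! l $ (is ! l)))"

lemma finite_lists_of_UNIV: "finite (lists_of (UNIV :: 'n::finite set) k)"
  by (rule finite_lists_length_eq) simp

lemma multilinear_sign_form:
  fixes \<sigma> :: "'n::finite list \<Rightarrow> real"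
  shows "multilinear_form (*s) k (sign_form k \<sigma> :: ('k::real_normed_field ^ 'n) list \<Rightarrow> 'k)"
  unfolding sign_form_def[abs_def]
proof (rule multilinear_form_sum)
  show "lists_of (UNIV :: 'n set) k \<noteq> {}"
    using Ex_list_of_length[of k] by auto
  show "multilinear_form (*s) k (\<lambda>ys :: ('k ^ 'n) list. \<Prod>l<k. ys ! l $ (is ! l))" for "is" :: "'n list"
    by (rule multilinear_form_prod)
      (simp add: Vector_Spaces.linear_iff vec.vector_space_axioms
        vector_space_over_itself.vector_space_axioms)
qed (rule finite_lists_of_UNIV)

text \<open>The test points are all k-tuples from the net, each paired with a real coordinate
  direction of the field, since the signs are balanced against real numbers. The logarithm of their
  number is at most linear in k, so \<open>D\<close> depends on the net but not on k.\<close>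

lemma exists_small_sign_form:
  fixes \<delta> :: real
  assumes \<delta>: "0 < \<delta>" "\<delta> < 1"
  obtains D :: real where "D > 0"
    "\<And>k. 0 < k \<Longrightarrow> \<exists>\<sigma>. (\<forall>is. \<sigma> is = 1 \<or> \<sigma> is = -1) \<and>
      (\<forall>ys :: ('k::{real_normed_field, euclidean_space} ^ 'n::finite) list. length ys = k \<longrightarrow>
        norm (sign_form k \<sigma> ys) \<le> D * k / (1 - \<delta>) ^ k * (\<Prod>l<k. norm (ys ! l)))"
proof -
  obtain P :: "('k ^ 'n) set" where P: "finite P" "P \<noteq> {}" "P \<subseteq> cball 0 1"
    "\<And>y. norm y \<le> 1 \<Longrightarrow> \<exists>p\<in>P. norm (y - p) \<le> \<delta>"
    using finite_net[OF \<delta>(1)] by metis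
  define d where "d = real DIM('k)"
  have d: "d \<ge> 1" unfolding d_def using DIM_positive[where 'a = 'k] by linarith
  have cP: "real (card P) \<ge> 1" using P by (simp add: Suc_le_eq card_gt_0_iff)
  \<comment> \<open>The two logarithms count coordinate directions and net points; the outer factor
    \<open>d\<close> pays for adding the real coordinates of the value of the form.\<close>
  define D where "D = d * (1 + ln (2 * d) + ln (card P))"
  have D: "D > 0" using d cP by (auto simp: D_def intro!: mult_pos_pos add_pos_nonneg)
  have "\<exists>\<sigma>. (\<forall>is. \<sigma> is = 1 \<or> \<sigma> is = -1) \<and> (\<forall>ys :: ('k ^ 'n) list. length ys = k \<longrightarrow>
        norm (sign_form k \<sigma> ys) \<le> D * k / (1 - \<delta>) ^ k * (\<Prod>l<k. norm (ys ! l)))"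
    if k: "0 < k" for k
  proof -
    define Q where "Q = lists_of P k \<times> (Basis :: 'k set)"
    define r where "r = (\<lambda>(ps :: ('k ^ 'n) list, u :: 'k) is. (\<Prod>l<k. ps ! l $ (is ! l)) \<bullet> u)"
    have finQ: "finite Q" using P(1) by (simp add: Q_def finite_lists_length_eq)
    \<comment> \<open>The numbers \<open>r q is\<close> are one real coordinate of the entries of an
      elementary tensor. The sum of the squared moduli of these entries is the product of the
      squared norms of its factors, all in the unit ball.\<close>
    have rle: "(\<Sum>is\<in>lists_of UNIV k. (r q is)\<^sup>2) \<le> 1" if q: "q \<in> Q" for q
    proof -
      obtain ps u where psu: "q = (ps, u)" "ps \<in> lists_of P k" "u \<in> Basis"
        using q by (auto simp: Q_def)
      have "(r q is)\<^sup>2 \<le> (\<Prod>l<k. (norm (ps ! l $ (is ! l)))\<^sup>2)" for "is"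
      proof -
        have "\<bar>r q is\<bar> \<le> norm (\<Prod>l<k. ps ! l $ (is ! l))"
          using Basis_le_norm[OF psu(3)] by (simp add: r_def psu(1))
        then show ?thesis
          by (metis abs_ge_zero power2_abs power_mono prod_norm prod_power_distrib)
      qed
      then have "(\<Sum>is\<in>lists_of UNIV k. (r q is)\<^sup>2) \<le>
          (\<Sum>is\<in>lists_of UNIV k. \<Prod>l<k. (norm (ps ! l $ (is ! l)))\<^sup>2)"
        by (rule sum_mono)
      also have "\<dots> = (\<Prod>l<k. \<Sum>i\<in>UNIV. (norm (ps ! l $ i))\<^sup>2)"
        by (rule prod_sum_lists)
      also have "\<dots> = (\<Prod>l<k. (norm (ps ! l))\<^sup>2)"
        by (simp add: norm_vec_def L2_set_def sum_nonneg)
      also have "\<dots> \<le> 1"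
        using psu(2) P(3) by (intro prod_le_1) (auto intro!: power_le_one dest!: nth_mem)
      finally show ?thesis .
    qed
    obtain \<sigma> :: "'n list \<Rightarrow> real" where \<sigma>: "\<And>i. \<sigma> i = 1 \<or> \<sigma> i = -1"
      "\<And>q. q \<in> Q \<Longrightarrow> \<bar>\<Sum>is\<in>lists_of UNIV k. \<sigma> is * r q is\<bar> \<le> 1 + ln (2 * card Q)"
      using exists_signs[of "lists_of UNIV k" Q r, OF finite_lists_of_UNIV finQ rle] by blast
    have "card Q = card P ^ k * DIM('k)"
      by (simp add: Q_def card_cartesian_product card_lists_length_eq[OF P(1)])
    then have "1 + ln (2 * card Q) = 1 + ln (2 * d) + k * ln (card P)"
      using cP d by (simp add: d_def ln_mult ln_realpow)
    also have "\<dots> \<le> k * (1 + ln (2 * d)) + k * ln (card P)"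
    proof -
      have "1 * (1 + ln (2 * d)) \<le> k * (1 + ln (2 * d))"
        using k d by (intro mult_right_mono) auto
      then show ?thesis by simp
    qed
    finally have lnQ: "1 + ln (2 * card Q) \<le> k * (1 + ln (2 * d) + ln (card P))"
      by (simp add: algebra_simps)
    have small: "norm (sign_form k \<sigma> ps) \<le> D * k" if ps: "ps \<in> lists_of P k" for ps :: "('k ^ 'n) list"
    proof -
      have "norm (sign_form k \<sigma> ps) \<le> (\<Sum>u\<in>Basis. \<bar>sign_form k \<sigma> ps \<bullet> u\<bar>)"
        by (rule norm_le_l1)
      also have "\<dots> \<le> (\<Sum>u\<in>(Basis :: 'k set). k * (1 + ln (2 * d) + ln (card P)))"
      proof (rule sum_mono)
        fix u :: 'k assume u: "u \<in> Basis"
        have "sign_form k \<sigma> ps \<bullet> u = (\<Sum>is\<in>lists_of UNIV k. \<sigma> is * r (ps, u) is)"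
          by (simp add: sign_form_def r_def inner_sum_left flip: scaleR_conv_of_real)
        then show "\<bar>sign_form k \<sigma> ps \<bullet> u\<bar> \<le> k * (1 + ln (2 * d) + ln (card P))"
          using \<sigma>(2)[of "(ps, u)"] lnQ ps u by (simp add: Q_def)
      qed
      also have "\<dots> = D * k" by (simp add: D_def d_def)
      finally show ?thesis .
    qed
    have "norm (sign_form k \<sigma> ys) \<le> D * k / (1 - \<delta>) ^ k * (\<Prod>l<k. norm (ys ! l))"
      if "length ys = k" for ys :: "('k ^ 'n) list"
      by (rule multilinear_form_net_bound[OF P(4) \<delta>(2) multilinear_sign_form small that])
    with \<sigma>(1) show ?thesis by blast
  qed
  with D show ?thesis using that by blast
qed

subsection \<open>The lower bound and the limit\<close>

lemma tensor_power_finite_sum: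
  assumes Q: "finite Q" and x: "\<And>q. q \<in> Q \<Longrightarrow> length (x q) = k"
  shows "(\<lambda>A. \<Sum>q\<in>Q. c q * elementary_tensor smul (x q) A) \<in> tensor_power smul k"
proof -
  obtain h where h: "bij_betw h {..<card Q} Q"
    using ex_bij_betw_nat_finite[OF Q] by (auto simp: atLeast0LessThan)
  then have "h i \<in> Q" if "i < card Q" for i using that bij_betwE by blast
  then show ?thesis
    unfolding tensor_power_def using x
    by (intro CollectI exI[of _ "card Q"] exI[of _ "c \<circ> h"] exI[of _ "x \<circ> h"])
      (simp add: sum.reindex_bij_betw[OF h, symmetric])
qed

lemma sign_form_axis:
  fixes js :: "'n::finite list"
  assumes "length js = k"
  shows "(sign_form k \<sigma> (map (\<lambda>i. axis i 1) js) :: 'k::real_normed_field) = of_real (\<sigma> js)"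
proof -
  have "of_real (\<sigma> is) * (\<Prod>l<k. map (\<lambda>i. axis i (1 :: 'k)) js ! l $ (is ! l)) =
      (if is = js then of_real (\<sigma> js) else 0)" if mem: "is \<in> lists_of UNIV k" for "is"
  proof (cases "is = js")
    case False
    then obtain l where "l < k" "is ! l \<noteq> js ! l"
      using mem assms by (auto simp: list_eq_iff_nth_eq)
    then have "(\<Prod>l<k. map (\<lambda>i. axis i (1 :: 'k)) js ! l $ (is ! l)) = 0"
      using assms by (intro prod_zero) (auto intro!: bexI[of _ l] simp: axis_def)
    then show ?thesis using False by simp
  next
    case True
    then show ?thesis using assms by (simp add: axis_def)
  qed
  then have "sign_form k \<sigma> (map (\<lambda>i. axis i 1) js) =
      (\<Sum>is\<in>lists_of UNIV k. if is = js then of_real (\<sigma> js) else (0 :: 'k))"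
    unfolding sign_form_def by (rule sum.cong[OF refl])
  then show ?thesis using assms finite_lists_of_UNIV[of k, where 'n = 'n] by simp
qed

context proportional_ellipsoids
begin

lemma norm_coordinates_dual_le:
  assumes l: "l \<in> dual_unit_ball smul N"
  shows "norm (\<chi> i. l (T (axis i 1))) \<le> 1"
proof -
  define y where "y = (\<chi> i. l (T (axis i 1)))"
  \<comment> \<open>The vector conjugate to \<open>y\<close> is the extremal test: \<open>l\<close>
    takes the value norm y squared at \<open>T x\<close>, while \<open>N (T x)\<close> is at most
    norm y.\<close>
  define x where "x = (\<chi> i. cj (y $ i))"
  have lin: "Vector_Spaces.linear smul (*) l" using l by (simp add: dual_unit_ball_def)
  have "l (T x) = l (T (\<Sum>i\<in>UNIV. x $ i *s axis i 1))"
    by (simp only: basis_expansion)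
  also have "\<dots> = (\<Sum>i\<in>UNIV. cj (y $ i) * y $ i)"
    by (simp add: T_simps vector_space_linearD[OF lin] x_def y_def)
  also have "\<dots> = of_real ((norm y)\<^sup>2)"
    unfolding herm_self[symmetric] herm_def by (simp add: mult.commute)
  finally have "(norm y)\<^sup>2 \<le> N (T x)"
    using dual_unit_ball_le[OF l, of "T x"] by (simp add: norm_power)
  also have "\<dots> \<le> norm x" by (rule N_T_le)
  also have "norm x = norm y" by (simp add: x_def norm_vec_def)
  finally have "norm y * norm y \<le> norm y" by (simp add: power2_eq_square)
  then have "norm y \<le> 1" by (cases "norm y = 0") (auto simp: mult_le_cancel_right1)
  then show ?thesis by (simp add: y_def)
qed

definition sign_tensor :: "nat \<Rightarrow> ('n list \<Rightarrow> real) \<Rightarrow> ('a list \<Rightarrow> 'k) \<Rightarrow> 'k" where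
  "sign_tensor k \<sigma> = (\<lambda>A. \<Sum>is\<in>lists_of UNIV k. of_real (\<sigma> is) *
     elementary_tensor smul (map (\<lambda>i. T (axis i 1)) is) A)"

lemma sign_tensor_eval:
  "multilinear_form smul k A \<Longrightarrow>
    sign_tensor k \<sigma> A = (\<Sum>is\<in>lists_of UNIV k. of_real (\<sigma> is) * A (map (\<lambda>i. T (axis i 1)) is))"
  unfolding sign_tensor_def by (rule sum.cong) (auto simp: elementary_tensor_def)

lemma sign_tensor_in_tensor_power: "sign_tensor k \<sigma> \<in> tensor_power smul k"
  unfolding sign_tensor_def
  by (rule tensor_power_finite_sum[OF finite_lists_of_UNIV]) simp

text \<open>A product functional sees the tensor as the sign form evaluated at the coordinate
  vectors of its factors, and these lie in the Euclidean unit ball.\<close>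

lemma injective_norm_sign_tensor_le:
  assumes G: "\<And>ys :: ('k ^ 'n) list. length ys = k \<Longrightarrow> norm (sign_form k \<sigma> ys) \<le> G * (\<Prod>l<k. norm (ys ! l))"
    and "0 \<le> G"
  shows "injective_norm smul N k (sign_tensor k \<sigma>) \<le> G"
proof (rule injective_norm_le)
  fix l :: "nat \<Rightarrow> 'a \<Rightarrow> 'k" assume l: "\<And>j. j < k \<Longrightarrow> l j \<in> dual_unit_ball smul N"
  define ys where "ys = map (\<lambda>j. \<chi> i. l j (T (axis i 1))) [0..<k]"
  have "multilinear_form smul k (\<lambda>xs. \<Prod>j<k. l j (xs ! j))"
    using l by (intro multilinear_form_prod) (auto simp: dual_unit_ball_def)
  then have "tensor_functional k l (sign_tensor k \<sigma>) = sign_form k \<sigma> ys"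
    unfolding tensor_functional_def sign_form_def
    by (subst sign_tensor_eval) (auto intro!: sum.cong simp: ys_def)
  also have "norm \<dots> \<le> G * (\<Prod>l<k. norm (ys ! l))" by (rule G) (simp add: ys_def)
  also have "\<dots> \<le> G * 1"
    using l \<open>0 \<le> G\<close>
    by (intro mult_left_mono prod_le_1) (auto simp: ys_def norm_coordinates_dual_le)
  finally show "norm (tensor_functional k l (sign_tensor k \<sigma>)) \<le> G" by simp
qed

lemma projective_norm_sign_tensor_ge:
  assumes \<sigma>: "\<And>is. \<sigma> is = 1 \<or> \<sigma> is = -1"
    and G: "\<And>ys :: ('k ^ 'n) list. length ys = k \<Longrightarrow> norm (sign_form k \<sigma> ys) \<le> G * (\<Prod>l<k. norm (ys ! l))"
    and G0: "0 < G" and k: "0 < k"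
  shows "(CARD('n) / c) ^ k / G \<le> projective_norm smul N k (sign_tensor k \<sigma>)"
  unfolding projective_norm_eq_Inf
proof (rule cInf_greatest)
  show "projective_sums smul N k (sign_tensor k \<sigma>) \<noteq> {}"
    using projective_sums_mem[OF finite_lists_of_UNIV _ k sign_tensor_def] by auto
  \<comment> \<open>The form has the coefficients of the tensor, so each term of the pairing is a
    squared sign. Passing through \<open>inv T\<close> costs a factor \<open>c\<close> per slot by
    \<open>norm_le\<close>.\<close>
  define A :: "'a list \<Rightarrow> 'k" where
    "A xs = (\<Sum>is\<in>lists_of UNIV k. of_real (\<sigma> is) * (\<Prod>l<k. inv T (xs ! l) $ (is ! l)))" for xs
  have A: "multilinear_form smul k A"
    unfolding A_def[abs_def]
  proof (rule multilinear_form_sum)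
    show "lists_of (UNIV :: 'n set) k \<noteq> {}"
      using Ex_list_of_length[of k] by auto
    show "multilinear_form smul k (\<lambda>xs. \<Prod>l<k. inv T (xs ! l) $ (is ! l))" for "is" :: "'n list"
      by (rule multilinear_form_prod)
        (simp add: Vector_Spaces.linear_iff inv_T_simps vector_space_axioms
          vector_space_over_itself.vector_space_axioms)
  qed (rule finite_lists_of_UNIV)
  have A_eq: "A xs = sign_form k \<sigma> (map (inv T) xs)" if "length xs = k" for xs
    using that by (simp add: A_def sign_form_def)
  have "sign_tensor k \<sigma> A = (\<Sum>is\<in>lists_of (UNIV :: 'n set) k. 1)"
    unfolding sign_tensor_eval[OF A]
  proof (rule sum.cong[OF refl])
    fix js :: "'n list" assume "js \<in> lists_of UNIV k"
    then have "A (map (\<lambda>i. T (axis i 1)) js) = of_real (\<sigma> js)"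
      by (simp add: A_eq o_def sign_form_axis)
    then show "of_real (\<sigma> js) * A (map (\<lambda>i. T (axis i 1)) js) = 1"
      using \<sigma>[of js] by auto
  qed
  then have val: "sign_tensor k \<sigma> A = of_nat (CARD('n) ^ k)"
    using card_lists_length_eq[of "UNIV :: 'n set" k] by simp
  fix r assume "r \<in> projective_sums smul N k (sign_tensor k \<sigma>)"
  then obtain m :: nat and x where r: "r = (\<Sum>i<m. \<Prod>j<k. N (x i ! j))"
    and x: "\<And>i. i < m \<Longrightarrow> length (x i) = k"
    and z: "sign_tensor k \<sigma> = (\<lambda>A. \<Sum>i<m. elementary_tensor smul (x i) A)"
    unfolding projective_sums_def by blast
  have "real (CARD('n) ^ k) = norm (sign_tensor k \<sigma> A)" by (simp add: val norm_power)
  also have "sign_tensor k \<sigma> A = (\<Sum>i<m. A (x i))"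
    unfolding z using A x by (intro sum.cong) (auto simp: elementary_tensor_def)
  also have "norm \<dots> \<le> (\<Sum>i<m. G * c ^ k * (\<Prod>j<k. N (x i ! j)))"
  proof (rule sum_norm_le)
    fix i assume i: "i \<in> {..<m}"
    have "norm (A (x i)) \<le> G * (\<Prod>l<k. norm (map (inv T) (x i) ! l))"
      using G[of "map (inv T) (x i)"] x i by (simp add: A_eq)
    also have "\<dots> \<le> G * (\<Prod>l<k. c * N (x i ! l))"
      using G0 x i norm_le[of "inv T _"] by (intro mult_left_mono prod_mono) auto
    finally show "norm (A (x i)) \<le> G * c ^ k * (\<Prod>j<k. N (x i ! j))"
      by (simp add: prod.distrib mult.assoc)
  qed
  also have "\<dots> = G * c ^ k * r" by (simp add: r sum_distrib_left)
  finally show "(CARD('n) / c) ^ k / G \<le> r"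
    using G0 c_pos by (simp add: power_divide field_simps)
qed

text \<open>At basis vectors the form takes a value of modulus 1. This makes \<open>G\<close> a
  legitimate denominator below.\<close>

lemma sign_form_bound_ge_one:
  assumes \<sigma>: "\<And>is. \<sigma> is = 1 \<or> \<sigma> is = -1"
    and G: "\<And>ys :: ('k ^ 'n) list. length ys = k \<Longrightarrow> norm (sign_form k \<sigma> ys) \<le> G * (\<Prod>l<k. norm (ys ! l))"
  shows "1 \<le> G"
proof -
  obtain js :: "'n list" where js: "length js = k" using Ex_list_of_length by blast
  have ax: "norm (axis i (1 :: 'k)) = 1" for i :: 'n
    unfolding norm_eq_1 inner_axis_axis by (simp add: dot_square_norm)
  have "1 = norm (sign_form k \<sigma> (map (\<lambda>i. axis i (1 :: 'k)) js))"
    using \<sigma>[of js] by (auto simp: sign_form_axis[OF js])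
  also have "\<dots> \<le> G * (\<Prod>l<k. norm (map (\<lambda>i. axis i (1 :: 'k)) js ! l))"
    using js by (intro G) simp
  also have "\<dots> = G" using js ax by simp
  finally show ?thesis .
qed

lemma ratio_lower_bound:
  assumes \<sigma>: "\<And>is. \<sigma> is = 1 \<or> \<sigma> is = -1"
    and G: "\<And>ys :: ('k ^ 'n) list. length ys = k \<Longrightarrow> norm (sign_form k \<sigma> ys) \<le> G * (\<Prod>l<k. norm (ys ! l))"
    and k: "0 < k"
  shows "(CARD('n) / c) ^ k / G\<^sup>2 \<le>
      projective_norm smul N k (sign_tensor k \<sigma>) / injective_norm smul N k (sign_tensor k \<sigma>)"
    and "sign_tensor k \<sigma> \<noteq> (\<lambda>A. 0)"
proof -
  have G1: "1 \<le> G" using \<sigma> G by (rule sign_form_bound_ge_one)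
  define \<epsilon> where "\<epsilon> = injective_norm smul N k (sign_tensor k \<sigma>)"
  define p where "p = projective_norm smul N k (sign_tensor k \<sigma>)"
  have n: "0 < (CARD('n) / c) ^ k" using c_pos by simp
  have le: "\<epsilon> \<le> G" unfolding \<epsilon>_def using G1 by (intro injective_norm_sign_tensor_le G) auto
  have ge: "(CARD('n) / c) ^ k / G \<le> p"
    unfolding p_def using G1 by (intro projective_norm_sign_tensor_ge \<sigma> G k) auto
  have "0 < (CARD('n) / c) ^ k / G" using n G1 by simp
  then have p: "0 < p" using ge by linarith
  \<comment> \<open>The upper bound is reused to see that the injective norm is positive; a zero
    denominator would turn the quotient into 0.\<close>
  have "p \<le> (CARD('n) / c) ^ k * \<epsilon>"
    unfolding p_def \<epsilon>_def
    by (rule projective_norm_le_injective_norm[OF sign_tensor_in_tensor_power k])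
  then have "0 < (CARD('n) / c) ^ k * \<epsilon>" using p by linarith
  then have \<epsilon>: "0 < \<epsilon>" by (rule zero_less_mult_pos[OF _ n])
  have "(CARD('n) / c) ^ k / G / G \<le> p / \<epsilon>"
    using ge le \<epsilon> p by (intro frac_le) auto
  then show "(CARD('n) / c) ^ k / G\<^sup>2 \<le>
      projective_norm smul N k (sign_tensor k \<sigma>) / injective_norm smul N k (sign_tensor k \<sigma>)"
    by (simp add: p_def \<epsilon>_def power2_eq_square)
  show "sign_tensor k \<sigma> \<noteq> (\<lambda>A. 0)"
  proof
    assume "sign_tensor k \<sigma> = (\<lambda>A. 0)"
    then have "\<epsilon> \<le> 0" unfolding \<epsilon>_def by (intro injective_norm_le) (simp add: tensor_functional_def)
    then show False using \<epsilon> by simp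
  qed
qed

lemma tensor_ratio_root_bounds:
  assumes \<sigma>: "\<And>is. \<sigma> is = 1 \<or> \<sigma> is = -1"
    and G: "\<And>ys :: ('k ^ 'n) list. length ys = k \<Longrightarrow> norm (sign_form k \<sigma> ys) \<le> G * (\<Prod>l<k. norm (ys ! l))"
    and k: "0 < k"
  shows "tensor_ratio_root smul N k \<le> CARD('n) / c"
    and "root k ((CARD('n) / c) ^ k / G\<^sup>2) \<le> tensor_ratio_root smul N k"
proof -
  define R where "R = {projective_norm smul N k z / injective_norm smul N k z | z.
                    z \<in> tensor_power smul k \<and> z \<noteq> (\<lambda>A. 0)}"
  have ub: "r \<le> (CARD('n) / c) ^ k" if r: "r \<in> R" for r
  proof -
    obtain z where z: "z \<in> tensor_power smul k"
      and r: "r = projective_norm smul N k z / injective_norm smul N k z"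
      using r by (auto simp: R_def)
    show ?thesis
    proof (cases "injective_norm smul N k z = 0")
      \<comment> \<open>With x / 0 = 0 this case is harmless, so definiteness of the injective norm
        does not have to be established.\<close>
      case True
      then show ?thesis using r c_pos by simp
    next
      case False
      then have "0 < injective_norm smul N k z" using injective_norm_nonneg[OF z] by simp
      then show ?thesis
        using projective_norm_le_injective_norm[OF z k] by (simp add: r divide_le_eq)
    qed
  qed
  define r where "r = projective_norm smul N k (sign_tensor k \<sigma>) / injective_norm smul N k (sign_tensor k \<sigma>)"
  \<comment> \<open>Membership also shows that \<open>R\<close> is nonempty, which even the upper
    estimate of \<open>Sup R\<close> relies on.\<close>
  have rR: "r \<in> R"
    using ratio_lower_bound(2)[OF \<sigma> G k] sign_tensor_in_tensor_power by (auto simp: R_def r_def)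
  have "Sup R \<le> (CARD('n) / c) ^ k" using rR ub by (intro cSup_least) auto
  then have "root k (Sup R) \<le> root k ((CARD('n) / c) ^ k)" using k by simp
  then show "tensor_ratio_root smul N k \<le> CARD('n) / c"
    using k c_pos by (simp add: tensor_ratio_root_def R_def[symmetric] real_root_power_cancel)
  have "(CARD('n) / c) ^ k / G\<^sup>2 \<le> r"
    unfolding r_def by (rule ratio_lower_bound(1)[OF \<sigma> G k])
  also have "r \<le> Sup R" using rR ub by (intro cSup_upper bdd_aboveI[of R]) auto
  finally show "root k ((CARD('n) / c) ^ k / G\<^sup>2) \<le> tensor_ratio_root smul N k"
    using k by (simp add: tensor_ratio_root_def R_def[symmetric])
qed

text \<open>\<open>D\<close> may depend on \<delta> but not on k, so its k-th root tends to 1 for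
  fixed \<delta>.\<close>

lemma tensor_ratio_root_lower:
  assumes \<delta>: "0 < \<delta>" "\<delta> < 1"
  obtains D :: real where "0 < D"
    "\<And>k. 0 < k \<Longrightarrow> tensor_ratio_root smul N k \<le> CARD('n) / c"
    "\<And>k. 0 < k \<Longrightarrow>
      CARD('n) / c * (1 - \<delta>)\<^sup>2 / (root k D * root k k)\<^sup>2 \<le> tensor_ratio_root smul N k"
proof -
  obtain D :: real where D: "D > 0"
    "\<And>k. 0 < k \<Longrightarrow> \<exists>\<sigma>. (\<forall>is. \<sigma> is = 1 \<or> \<sigma> is = -1) \<and>
      (\<forall>ys :: ('k ^ 'n) list. length ys = k \<longrightarrow>
        norm (sign_form k \<sigma> ys) \<le> D * k / (1 - \<delta>) ^ k * (\<Prod>l<k. norm (ys ! l)))"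
    using exists_small_sign_form[OF \<delta>, where 'k = 'k and 'n = 'n] by blast
  have "tensor_ratio_root smul N k \<le> CARD('n) / c \<and>
      CARD('n) / c * (1 - \<delta>)\<^sup>2 / (root k D * root k k)\<^sup>2 \<le> tensor_ratio_root smul N k"
    if k: "0 < k" for k
  proof -
    define G where "G = D * k / (1 - \<delta>) ^ k"
    obtain \<sigma> :: "'n list \<Rightarrow> real" where \<sigma>: "\<And>is. \<sigma> is = 1 \<or> \<sigma> is = -1"
      "\<And>ys :: ('k ^ 'n) list. length ys = k \<Longrightarrow> norm (sign_form k \<sigma> ys) \<le> G * (\<Prod>l<k. norm (ys ! l))"
      using D(2)[OF k] unfolding G_def by blast
    have "root k ((CARD('n) / c) ^ k / G\<^sup>2) = CARD('n) / c / (root k G)\<^sup>2"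
    proof -
      have "root k ((CARD('n) / c) ^ k) = CARD('n) / c"
        using k c_pos by (intro real_root_power_cancel) auto
      then show ?thesis using k by (simp only: real_root_divide[of k "_ ^ k"] real_root_power)
    qed
    also have "root k G = root k D * root k k / (1 - \<delta>)"
      using k \<delta> by (simp add: G_def real_root_divide real_root_mult real_root_power_cancel)
    also have "CARD('n) / c / (root k D * root k k / (1 - \<delta>))\<^sup>2 =
        CARD('n) / c * (1 - \<delta>)\<^sup>2 / (root k D * root k k)\<^sup>2"
      by (simp add: power_divide)
    finally show ?thesis using tensor_ratio_root_bounds[OF \<sigma> k] by simp
  qed
  with D(1) show ?thesis using that by blast
qed

lemma tensor_ratio_root_tendsto: "(\<lambda>k. tensor_ratio_root smul N k) \<longlonglongrightarrow> CARD('n) / c"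
proof (rule order_tendstoI)
  fix a :: real assume a: "a < CARD('n) / c"
  have "((\<lambda>\<delta>. CARD('n) / c * (1 - \<delta>)\<^sup>2) \<longlongrightarrow> CARD('n) / c * (1 - 0)\<^sup>2) (at_right 0)"
    by (intro tendsto_intros)
  then have "eventually (\<lambda>\<delta>. a < CARD('n) / c * (1 - \<delta>)\<^sup>2) (at_right 0)"
    using a by (intro order_tendstoD(1)) auto
  moreover have "eventually (\<lambda>\<delta> :: real. \<delta> \<in> {0<..<1}) (at_right 0)"
    by (rule eventually_at_right_real) simp
  ultimately have "eventually (\<lambda>\<delta>. a < CARD('n) / c * (1 - \<delta>)\<^sup>2 \<and> \<delta> \<in> {0<..<1}) (at_right 0)"
    by (rule eventually_conj)
  then obtain \<delta> where \<delta>: "a < CARD('n) / c * (1 - \<delta>)\<^sup>2" "0 < \<delta>" "\<delta> < 1"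
    using eventually_happens[of _ "at_right (0 :: real)"] by auto
  obtain D :: real where D: "0 < D" "\<And>k. 0 < k \<Longrightarrow>
      CARD('n) / c * (1 - \<delta>)\<^sup>2 / (root k D * root k k)\<^sup>2 \<le> tensor_ratio_root smul N k"
    using tensor_ratio_root_lower[OF \<delta>(2,3)] by metis
  have "(\<lambda>k. CARD('n) / c * (1 - \<delta>)\<^sup>2 / (root k D * root k k)\<^sup>2) \<longlonglongrightarrow>
      CARD('n) / c * (1 - \<delta>)\<^sup>2 / (1 * 1)\<^sup>2"
    using D(1) by (intro tendsto_intros LIMSEQ_root LIMSEQ_root_const) auto
  then have "eventually (\<lambda>k. a < CARD('n) / c * (1 - \<delta>)\<^sup>2 / (root k D * root k k)\<^sup>2) sequentially"
    using \<delta>(1) by (intro order_tendstoD(1)) auto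
  then show "eventually (\<lambda>k. a < tensor_ratio_root smul N k) sequentially"
    using eventually_gt_at_top[of 0] by eventually_elim (rule less_le_trans[OF _ D(2)])
next
  fix a :: real assume a: "CARD('n) / c < a"
  obtain D :: real where D: "\<And>k. 0 < k \<Longrightarrow> tensor_ratio_root smul N k \<le> CARD('n) / c"
    \<comment> \<open>Any admissible \<delta> serves here, as the upper bound is the same for all of
      them.\<close>
    using tensor_ratio_root_lower[of "1 / 2"] by auto
  show "eventually (\<lambda>k. tensor_ratio_root smul N k < a) sequentially"
    by (rule eventually_mono[OF eventually_gt_at_top[of 0]]) (rule le_less_trans[OF D a])
qed

theorem tensor_radius_eq:
  "tensor_radius smul N =
    CARD('n) / banach_mazur_distance smul N ((*s) :: 'k \<Rightarrow> 'k ^ 'n \<Rightarrow> 'k ^ 'n) norm"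
  unfolding banach_mazur_distance_eq tensor_radius_def
  by (rule limI[OF tensor_ratio_root_tendsto])

end

section \<open>Reduction of the theorem to adapted coordinates\<close>

lemma surjective_linear_bij:
  fixes smul :: "'k::field \<Rightarrow> 'a::ab_group_add \<Rightarrow> 'a" and f :: "'k ^ 'n::finite \<Rightarrow> 'a"
  assumes f: "Vector_Spaces.linear (*s) smul f" and surj: "surj f"
    and dim: "vector_space.dim smul (UNIV :: 'a set) = CARD('n)"
  shows "bij f"
proof -
  interpret V: vector_space smul using f by (simp add: Vector_Spaces.linear_iff)
  obtain B where B: "V.independent B" "V.span B = UNIV" "card B = V.dim UNIV"
    using V.basis_exists[of UNIV] by (metis top.extremum_uniqueI)
  \<comment> \<open>An infinite set has \<open>card\<close> 0, so a dimension equal to the positive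
    number \<open>CARD('n)\<close> forces a finite basis.\<close>
  have "finite B" using B(3) dim by (metis card.infinite zero_less_card_finite less_irrefl)
  interpret V: finite_dimensional_vector_space smul B
    by unfold_locales (use B \<open>finite B\<close> in auto)
  interpret finite_dimensional_vector_space_pair "(*s) :: 'k \<Rightarrow> 'k ^ 'n \<Rightarrow> 'k ^ 'n" cart_basis smul B ..
  have "inj f"
    using f surj by (rule linear_surjective_imp_injective) (simp only: dim vec_dim_card)
  then show ?thesis using surj by (simp add: bij_def)
qed

theorem (in conjugation) tensor_radius_proportional_ellipsoids:
  fixes smul :: "'k \<Rightarrow> 'a::ab_group_add \<Rightarrow> 'a"
  assumes "normed_space smul N"
    and dim: "vector_space.dim smul (UNIV :: 'a set) = CARD('n::finite)"
    and J: "is_john_ellipsoid TYPE('n) smul N J"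
    and L: "is_loewner_ellipsoid TYPE('n) smul N L"
    and "proportional smul J L"
  shows "tensor_radius smul N =
    real CARD('n) / banach_mazur_distance smul N ((*s) :: 'k \<Rightarrow> 'k ^ 'n \<Rightarrow> 'k ^ 'n) norm"
proof -
  interpret normed_space smul N by fact
  obtain c where c: "c > 0" "L = smul (of_real c) ` J"
    using assms(5) by (auto simp: proportional_def)
  obtain T0 :: "'k ^ 'n \<Rightarrow> 'a" where T0: "Vector_Spaces.linear (*s) smul T0" "L = T0 ` cball 0 1"
    using L by (auto simp: is_loewner_ellipsoid_def ellipsoid_def)
  have ball_L: "unit_ball N \<subseteq> L" using L by (simp add: is_loewner_ellipsoid_def)
  have ball_J: "J \<subseteq> unit_ball N" using J by (simp add: is_john_ellipsoid_def)
  note lin0 = vector_space_linearD[OF T0(1)]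
  \<comment> \<open>An ellipsoid may be a degenerate linear image. Containing the unit ball forces
    \<open>T0\<close> to be surjective, and the explicit factor \<open>N x\<close> later yields
    \<open>norm_le\<close>.\<close>
  have absorb: "\<exists>w. norm w \<le> 1 \<and> x = T0 (N x *\<^sub>R w)" for x
  proof (cases "x = 0")
    case True
    then show ?thesis using norm_eq_zero_iff[of 0] lin0(4) by (auto intro!: exI[of _ 0])
  next
    case False
    then have pos: "0 < N x" using norm_nonneg[of x] norm_eq_zero_iff[of x] by simp
    then have "smul (of_real (1 / N x)) x \<in> unit_ball N"
      by (simp add: unit_ball_def norm_scale norm_divide)
    then obtain w where w: "norm w \<le> 1" "smul (of_real (1 / N x)) x = T0 w"
      using ball_L T0(2) by auto
    have "T0 (N x *\<^sub>R w) = smul (of_real (N x)) (smul (of_real (1 / N x)) x)"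
      unfolding of_real_smult[symmetric] lin0(2) w(2) ..
    also have "\<dots> = x" using pos by simp
    finally show ?thesis using w(1) by metis
  qed
  then have "surj T0" by (metis surjI surj_def)
  then have bij0: "bij T0" by (rule surjective_linear_bij[OF T0(1) _ dim])
  then have inj0: "T0 x = T0 y \<longleftrightarrow> x = y" for x y by (simp add: bij_is_inj inj_eq)
  \<comment> \<open>Since \<open>L\<close> is \<open>c\<close> times \<open>J\<close>, shrinking the
    parametrisation of \<open>L\<close> by \<open>c\<close> parametrises \<open>J\<close>.\<close>
  define T where "T x = T0 (of_real (1 / c) *s x)" for x
  have T: "Vector_Spaces.linear (*s) smul T"
    using T0(1) unfolding T_def Vector_Spaces.linear_iff
    by (simp add: vec.scale_right_distrib lin0(2) scale_left_commute)
  note lin = vector_space_linearD[OF T]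
  have T_scale: "T (c *\<^sub>R x) = T0 x" for x
    using c(1) by (simp add: T_def flip: of_real_smult of_real_mult)
  have smul_T: "smul (of_real c) (T x) = T0 x" for x
    by (simp add: T_scale[symmetric] lin(2) flip: of_real_smult)
  have inj: "T x = T y \<longleftrightarrow> x = y" for x y
    using c(1) by (simp add: T_def inj0 of_real_smult)
  have surj: "surj T"
  proof (rule surjI)
    show "T (c *\<^sub>R inv T0 x) = x" for x
      using bij0 by (simp add: T_scale bij_is_surj surj_f_inv_f)
  qed
  have J_eq: "J = T ` cball 0 1"
  proof (intro equalityI subsetI)
    fix x assume "x \<in> J"
    then obtain y where y: "y \<in> cball 0 1" "smul (of_real c) x = T0 y"
      using c(2) T0(2) by blast
    then have "smul (of_real c) x = smul (of_real c) (T y)" by (simp add: smul_T)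
    then have "x = T y" using c(1) by simp
    then show "x \<in> T ` cball 0 1" using y(1) by blast
  next
    fix x assume "x \<in> T ` cball 0 1"
    then obtain y where y: "y \<in> cball 0 1" "x = T y" by blast
    then have "smul (of_real c) x \<in> smul (of_real c) ` J" using c(2) T0(2) by (auto simp: smul_T)
    then show "x \<in> J" using c(1) by auto
  qed
  have vJ: "T -` J = cball 0 1" using inj by (auto simp: J_eq)
  have vL: "T -` L = cball 0 c"
  proof -
    have "L = T ` (*\<^sub>R) c ` cball 0 1" by (simp add: T0(2) image_image T_scale)
    also have "(*\<^sub>R) c ` cball 0 1 = cball (0 :: 'k ^ 'n) c" using c(1) by (simp add: cball_scale)
    finally show ?thesis using inj by auto
  qed
  have coord: "coordinates smul T"
    using T inj surj by (auto simp: coordinates_def bij_def inj_on_def)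
  interpret proportional_ellipsoids cj smul N T c
  proof (rule proportional_ellipsoids.intro[OF conjugation_axioms normed_space_axioms],
      rule proportional_ellipsoids_axioms.intro)
    show "Vector_Spaces.linear (*s) smul T" "bij T" "0 < c"
      using coord c(1) by (auto simp: coordinates_def)
    show "N (T x) \<le> norm x" for x
    proof -
      have "sgn x \<in> cball 0 1" by (simp add: norm_sgn)
      then have "T (sgn x) \<in> unit_ball N" using ball_J J_eq by blast
      then have "N (T (sgn x)) \<le> 1" by (simp add: unit_ball_def)
      then have "norm x * N (T (sgn x)) \<le> norm x" by (simp add: mult_left_le)
      moreover have "T x = smul (of_real (norm x)) (T (sgn x))"
        unfolding lin(2)[symmetric] of_real_smult by (cases "x = 0") (simp_all add: sgn_div_norm)
      ultimately show ?thesis by (simp add: norm_scale)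
    qed
    show "norm x \<le> c * N (T x)" for x
    proof -
      obtain w where w: "norm w \<le> 1" "T x = T0 (N (T x) *\<^sub>R w)" using absorb by blast
      then have "x = c *\<^sub>R N (T x) *\<^sub>R w" by (simp add: inj flip: T_scale)
      then have "norm x = c * N (T x) * norm w"
        using c(1) norm_nonneg[of "T x"] norm_scaleR[of "c * N (T x)" w] by simp
      also have "\<dots> \<le> c * N (T x)" using w(1) c(1) norm_nonneg by (simp add: mult_left_le)
      finally show ?thesis .
    qed
    show "measure lebesgue (T -` E) \<le> measure lebesgue (cball (0 :: 'k ^ 'n) 1)"
      if "ellipsoid TYPE('n) smul E" "E \<subseteq> unit_ball N" for E
    proof -
      have "volume T E \<le> volume T J"
        using J coord that unfolding is_john_ellipsoid_def by blast
      then show ?thesis by (simp only: volume_def vJ)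
    qed
    show "measure lebesgue (cball (0 :: 'k ^ 'n) c) \<le> measure lebesgue (T -` E)"
      if "ellipsoid TYPE('n) smul E" "unit_ball N \<subseteq> E" for E
    proof -
      have "volume T L \<le> volume T E"
        using L coord that unfolding is_loewner_ellipsoid_def by blast
      then show ?thesis by (simp only: volume_def vL)
    qed
  qed
  show ?thesis by (rule tensor_radius_eq)
qed

lemma conjugation_real: "conjugation (\<lambda>x :: real. x)"
  by unfold_locales (simp_all add: power2_eq_square)

lemma conjugation_complex: "conjugation cnj"
proof
  show "(a * x) \<bullet> y = x \<bullet> (cnj a * y)" for a x y
    by (simp add: inner_complex_def algebra_simps)
  show "a * cnj a = of_real ((norm a)\<^sup>2)" for a by (rule complex_norm_square[symmetric])
qed

theorem theorem1p2:
  "(\<forall>(smul :: real \<Rightarrow> 'a::ab_group_add \<Rightarrow> 'a) N J L.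
      normed_space smul N \<longrightarrow>
      vector_space.dim smul (UNIV :: 'a set) = CARD('n::finite) \<longrightarrow>
      is_john_ellipsoid TYPE('n) smul N J \<longrightarrow>
      is_loewner_ellipsoid TYPE('n) smul N L \<longrightarrow>
      proportional smul J L \<longrightarrow>
      tensor_radius smul N =
        real CARD('n) /
        banach_mazur_distance smul N ((*s) :: real \<Rightarrow> real ^ 'n \<Rightarrow> real ^ 'n) norm) \<and>
   (\<forall>(smul :: complex \<Rightarrow> 'b::ab_group_add \<Rightarrow> 'b) N J L.
      normed_space smul N \<longrightarrow>
      vector_space.dim smul (UNIV :: 'b set) = CARD('n) \<longrightarrow>
      is_john_ellipsoid TYPE('n) smul N J \<longrightarrow>
      is_loewner_ellipsoid TYPE('n) smul N L \<longrightarrow>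
      proportional smul J L \<longrightarrow>
      tensor_radius smul N =
        real CARD('n) /
        banach_mazur_distance smul N ((*s) :: complex \<Rightarrow> complex ^ 'n \<Rightarrow> complex ^ 'n) norm)"
  by (intro conjI allI impI
      conjugation.tensor_radius_proportional_ellipsoids[OF conjugation_real]
      conjugation.tensor_radius_proportional_ellipsoids[OF conjugation_complex])

end
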